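(* Consider the stump model $Y_i=f(i/N)+\varepsilon_i$, $i=1,\dots,N$, with $\varepsilon_i$ i.i.d. $N(0,\sigma^2)$ and $f(x)=\alpha 1(x\le\tau)+\beta 1(x>\tau)$, where $\alpha\neq\beta$ and $\tau\in(0,1)$ are constants; put $\Delta=\beta-\alpha$ and $\tau_N=\lfloor N\tau\rfloor/N$. Let $\hat\tau^{(2)}_N$ be the two-stage intelligent sampling estimator, $\lambda_2$ the signed counting distance, and $L_{\Delta/\sigma}$ the random variable described in the context. Then for every integer $\ell$, as $N\to\infty$, $$\mathbb P\big[\lambda_2(\tau_N,\hat\tau^{(2)}_N)=\ell\big]\to\mathbb P[L_{\Delta/\sigma}=\ell].$$
   Context: Two-stage intelligent sampling for a single change point. Fix constants $\gamma\in(0,1)$, $K_1,K_2>0$ and a small constant $\delta$ with $0<\delta<\gamma$; put $N_1=K_1N^\gamma$. Stage 1: let $S^{(1)}=\{i/N: i\in\mathbb N,\ i<N,\ i \text{ divisible by } \lfloor N/N_1\rfloor\}$. Using only the data $(i/N,Y_i)$ with $i/N\in S^{(1)}$, let $(\hat\alpha^{(1)},\hat\beta^{(1)},\hat\tau^{(1)}_N)$ be a minimizer over $(a,b,t)\in\mathbb R^2\times(0,1)$ of $\sum_{i/N\in S^{(1)}}\big(Y_i-a1(i/N\le t)-b1(i/N>t)\big)^2$, with $t$ taken in the grid $S^{(1)}$. Stage 2: let $S^{(2)}$ be the set of all $i/N$, $1\le i\le N$, with $i/N\in[\hat\tau^{(1)}_N-K_2N^{-\gamma+\delta},\hat\tau^{(1)}_N+K_2N^{-\gamma+\delta}]$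 and $i/N\notin S^{(1)}$. The estimator $\hat\tau^{(2)}_N$ is the minimizer over $d\in S^{(2)}$ of $$\sum_{i/N\in S^{(2)}}\big(Y_i-\hat\alpha^{(1)}1(i/N\le d)-\hat\beta^{(1)}1(i/N>d)\big)^2 .$$ Signed counting distance: for $a,b\in(0,1)$, $\lambda_2(a,b)=\sum_{i=1}^N1(a<i/N\le b,\ i/N\notin S^{(1)})$ if $a\le b$, and $\lambda_2(a,b)=-\sum_{i=1}^N1(b<i/N\le a,\ i/N\notin S^{(1)})$ otherwise. Limit variable: for real $\Delta\ne0$, $L_\Delta=\arg\min_{i\in\mathbb Z}X_\Delta(i)$, where $X_\Delta(0)=0$, $X_\Delta(i)=\operatorname{sgn}(\Delta)(\varepsilon_1^\diamond+\dots+\varepsilon_i^\diamond)+i|\Delta|/2$ for $i>0$, $X_\Delta(i)=-\operatorname{sgn}(\Delta)(\varepsilon_{i+1}^\diamond+\dots+\varepsilon_0^\diamond)+|i||\Delta|/2$ for $i<0$, and $(\varepsilon_j^\diamond)_{j\in\mathbb Z}$ are i.i.d. $N(0,1)$. *)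

theory Defs
  imports "HOL-Probability.Probability"
begin

definition stump :: "real \<Rightarrow> real \<Rightarrow> real \<Rightarrow> real \<Rightarrow> real" where
  "stump a b t x = a * of_bool (x \<le> t) + b * of_bool (x > t)"

definition iid_centered_normal :: "'a measure \<Rightarrow> real \<Rightarrow> ('i \<Rightarrow> 'a \<Rightarrow> real) \<Rightarrow> 'i set \<Rightarrow> bool" where
  "iid_centered_normal M \<sigma> e I \<longleftrightarrow>
     prob_space.indep_vars M (\<lambda>_. borel) e I \<and>
     (\<forall>i\<in>I. distributed M lborel (e i) (normal_density 0 \<sigma>))"

text \<open>
  The observations are indexed by \<open>1, \<dots>, N\<close>, so the subsample starts at \<open>i = 1\<close>. For the
  finitely many \<open>N\<close> with \<open>N < K1 * N powr \<gamma>\<close> the spacing is \<open>0\<close> and the subsample is empty.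
\<close>
definition stage1_grid :: "real \<Rightarrow> real \<Rightarrow> nat \<Rightarrow> real set" where
  "stage1_grid \<gamma> K1 N =
     {real i / real N | i::nat. 0 < i \<and> i < N \<and> nat \<lfloor>real N / (K1 * real N powr \<gamma>)\<rfloor> dvd i}"

definition stage2_grid :: "real \<Rightarrow> real \<Rightarrow> real \<Rightarrow> real \<Rightarrow> nat \<Rightarrow> real \<Rightarrow> real set" where
  "stage2_grid \<gamma> \<delta> K1 K2 N t1 =
     {real i / real N | i::nat. 1 \<le> i \<and> i \<le> N \<and>
        real i / real N \<in> {t1 - K2 * real N powr (-\<gamma> + \<delta>) .. t1 + K2 * real N powr (-\<gamma> + \<delta>)} \<and>
        real i / real N \<notin> stage1_grid \<gamma> K1 N}"

definition stump_loss :: "nat \<Rightarrow> real set \<Rightarrow> (nat \<Rightarrow> real) \<Rightarrow> real \<Rightarrow> real \<Rightarrow> real \<Rightarrow> real" where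
  "stump_loss N S y a b t =
     (\<Sum>i | i \<in> {1..N} \<and> real i / real N \<in> S. (y i - stump a b t (real i / real N))\<^sup>2)"

text \<open>
  Minimizers need not be unique (if \<open>t\<close> is the largest point of the first-stage grid, the loss
  does not depend on \<open>b\<close>), so both stages are predicates satisfied by every minimizer.
\<close>
definition stage1_minimizer ::
  "real \<Rightarrow> real \<Rightarrow> nat \<Rightarrow> (nat \<Rightarrow> real) \<Rightarrow> real \<Rightarrow> real \<Rightarrow> real \<Rightarrow> bool" where
  "stage1_minimizer \<gamma> K1 N y a1 b1 t1 \<longleftrightarrow>
     is_arg_min (\<lambda>(a, b, t). stump_loss N (stage1_grid \<gamma> K1 N) y a b t)
       (\<lambda>(a, b, t). t \<in> {0<..<1} \<and> t \<in> stage1_grid \<gamma> K1 N) (a1, b1, t1)"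

definition stage2_minimizer ::
  "real \<Rightarrow> real \<Rightarrow> real \<Rightarrow> real \<Rightarrow> nat \<Rightarrow> (nat \<Rightarrow> real) \<Rightarrow> real \<Rightarrow> real \<Rightarrow> real \<Rightarrow> real \<Rightarrow> bool" where
  "stage2_minimizer \<gamma> \<delta> K1 K2 N y a1 b1 t1 t2 \<longleftrightarrow>
     is_arg_min (\<lambda>d. stump_loss N (stage2_grid \<gamma> \<delta> K1 K2 N t1) y a1 b1 d)
       (\<lambda>d. d \<in> stage2_grid \<gamma> \<delta> K1 K2 N t1) t2"

definition signed_count :: "real \<Rightarrow> real \<Rightarrow> nat \<Rightarrow> real \<Rightarrow> real \<Rightarrow> int" where
  "signed_count \<gamma> K1 N a b =
     (if a \<le> b
      then (\<Sum>i=1..N. of_bool (a < real i / real N \<and> real i / real N \<le> b \<and>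
                               real i / real N \<notin> stage1_grid \<gamma> K1 N))
      else - (\<Sum>i=1..N. of_bool (b < real i / real N \<and> real i / real N \<le> a \<and>
                                 real i / real N \<notin> stage1_grid \<gamma> K1 N)))"

definition drift_walk :: "real \<Rightarrow> (int \<Rightarrow> real) \<Rightarrow> int \<Rightarrow> real" where
  "drift_walk D e i =
     (if i = 0 then 0
      else if i > 0 then sgn D * (\<Sum>j\<in>{1..i}. e j) + real_of_int i * \<bar>D\<bar> / 2
      else - sgn D * (\<Sum>j\<in>{i+1..0}. e j) + real_of_int \<bar>i\<bar> * \<bar>D\<bar> / 2)"

text \<open>
  The walk attains its minimum, at a unique point, only almost surely; \<open>L\<close> is therefore any
  integer-valued random variable that almost surely equals the minimizer.
\<close>
definition argmin_drift_walk :: "'b measure \<Rightarrow> real \<Rightarrow> (int \<Rightarrow> 'b \<Rightarrow> real) \<Rightarrow> ('b \<Rightarrow> int) \<Rightarrow> bool" where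
  "argmin_drift_walk M D e L \<longleftrightarrow>
     L \<in> measurable M (count_space UNIV) \<and>
     (AE \<omega> in M. is_arg_min (drift_walk D (\<lambda>j. e j \<omega>)) (\<lambda>_. True) (L \<omega>))"

end

theory Submission
  imports Defs "HOL-Real_Asymp.Real_Asymp"
begin

text \<open>
  Stage one: by a union bound over intervals, with probability tending to one every noise sum over an
  interval of the coarse grid is at most \<open>N powr (\<delta> / 4)\<close> times the square root of its length. On
  that event, comparing the fitted stump with the true one bounds the energy of their difference by
  \<open>12 * N powr (\<delta> / 2)\<close>; since the coarse grid has about \<open>N powr \<gamma>\<close> points, the fitted levels
  converge and the fitted change point is close enough for the second window to contain every
  fixed number of off-grid points around \<open>\<tau>\<close>.

  Stage two: numbering the off-grid indices by their signed rank relative to \<open>\<tau>\<close>, which is the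
  signed counting distance, turns the loss into a random walk in the rank that differs from the
  limiting drift walk (with the same noise) by a small multiple of the rank. Hence the rank of the
  estimator nearly minimizes a walk whose finite-dimensional laws are those of the limit.

  Limit: nearly minimizing at \<open>l\<close> over a finite window gives \<open>P (rank = l) \<le> P (L = l) + o(1)\<close> for each
  \<open>l\<close>. The limiting probabilities sum to at most one and the ranks are tight by Gaussian tails, so
  these upper bounds already force convergence.
\<close>

section \<open>Sums of Gaussian noise\<close>

text \<open>The exponent \<open>\<delta> / 4\<close> is squeezed from two sides. The union bound
  runs over about N^2 intervals, so the noise level has to grow with N. Its square enters the energy
  bound, and N^(\<delta>/2) must stay below both the N^\<gamma> points of the coarse grid and the
  factor N^\<delta> by which the second window exceeds the grid spacing. The second window and the
  levels in its loss are random. They are controlled pathwise on one event, and there the loss is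
  compared with a walk driven by renumbered noise with its unconditional law. Biased levels disturb
  the drift at every step, so the error of the comparison is proportional to the rank instead of
  uniform: it vanishes on fixed windows, and far out the drift dominates it. One-sided bounds are
  the natural outcome, since a minimizer over the whole second window is also a near-minimizer over
  every fixed finite window, while the converse would need control of all ranks at once. The slack
  disappears only in the limit, where ties have probability zero.\<close>

lemma normal_density_le_shift:
  assumes "0 \<le> a" "a \<le> x"
  shows "normal_density 0 s x \<le> exp (- (a\<^sup>2 / (2 * s\<^sup>2))) * normal_density a s x"
proof -
  have "0 \<le> a * (x - a)" using assms by simp
  then have "a\<^sup>2 + (x - a)\<^sup>2 \<le> x\<^sup>2"
    by (simp add: power2_eq_square algebra_simps)
  then have "- (x\<^sup>2 / (2 * s\<^sup>2)) \<le> - (a\<^sup>2 / (2 * s\<^sup>2)) + - ((x - a)\<^sup>2 / (2 * s\<^sup>2))"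
    using divide_right_mono[of "a\<^sup>2 + (x - a)\<^sup>2" "x\<^sup>2" "2 * s\<^sup>2"] by (simp add: add_divide_distrib)
  then show ?thesis
    by (simp add: normal_density_def mult.left_commute divide_right_mono flip: exp_add)
qed

text \<open>Enlarging the domain of the shifted density to the whole line costs only its total mass
  one, so the tail is purely exponential, without a prefactor depending on \<open>a\<close>.\<close>

lemma (in prob_space) normal_upper_tail:
  assumes X: "distributed M lborel X (normal_density 0 s)" and "0 < s" "0 \<le> a"
  shows "prob {\<omega> \<in> space M. a \<le> X \<omega>} \<le> exp (- (a\<^sup>2 / (2 * s\<^sup>2)))"
proof -
  have "emeasure M (X -` {a..} \<inter> space M) =
      (\<integral>\<^sup>+x. ennreal (normal_density 0 s x) * indicator {a..} x \<partial>lborel)"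
    by (rule distributed_emeasure[OF X]) simp
  also have "\<dots> \<le> (\<integral>\<^sup>+x. ennreal (exp (- (a\<^sup>2 / (2 * s\<^sup>2)))) * ennreal (normal_density a s x) \<partial>lborel)"
    using normal_density_le_shift[OF \<open>0 \<le> a\<close>, of _ s]
    by (intro nn_integral_mono)
      (auto simp: indicator_def ennreal_mult[symmetric] normal_density_nonneg intro!: ennreal_leI)
  also have "\<dots> = ennreal (exp (- (a\<^sup>2 / (2 * s\<^sup>2))))"
    using \<open>0 < s\<close> prob_space.emeasure_space_1[OF prob_space_normal_density[of s a]]
    by (subst nn_integral_cmult) (simp_all add: emeasure_density)
  finally show ?thesis
    by (simp add: emeasure_eq_measure vimage_def Int_def conj_commute)
qed

lemma (in prob_space) normal_tail:
  assumes X: "distributed M lborel X (normal_density 0 s)" and "0 < s" "0 \<le> a"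
  shows "prob {\<omega> \<in> space M. a \<le> \<bar>X \<omega>\<bar>} \<le> 2 * exp (- (a\<^sup>2 / (2 * s\<^sup>2)))"
proof -
  have [measurable]: "X \<in> borel_measurable M"
    using distributed_measurable[OF X] by simp
  have "distributed M lborel (\<lambda>x. - X x) (normal_density 0 s)"
    using normal_density_affine[OF X \<open>0 < s\<close>, of "-1" 0] by simp
  from normal_upper_tail[OF this \<open>0 < s\<close> \<open>0 \<le> a\<close>] normal_upper_tail[OF X \<open>0 < s\<close> \<open>0 \<le> a\<close>]
  have "prob {\<omega> \<in> space M. a \<le> X \<omega>} + prob {\<omega> \<in> space M. a \<le> - X \<omega>} \<le> 2 * exp (- (a\<^sup>2 / (2 * s\<^sup>2)))"
    by simp
  moreover have "prob {\<omega> \<in> space M. a \<le> \<bar>X \<omega>\<bar>} \<le>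
      prob ({\<omega> \<in> space M. a \<le> X \<omega>} \<union> {\<omega> \<in> space M. a \<le> - X \<omega>})"
    by (intro finite_measure_mono) auto
  moreover have "\<dots> \<le> prob {\<omega> \<in> space M. a \<le> X \<omega>} + prob {\<omega> \<in> space M. a \<le> - X \<omega>}"
    by (intro measure_Un_le) measurable
  ultimately show ?thesis by linarith
qed

lemma (in prob_space) normal_point_null:
  assumes X: "distributed M lborel X (normal_density \<mu> s)"
  shows "prob {\<omega> \<in> space M. X \<omega> = a} = 0"
proof -
  have "emeasure M (X -` {a} \<inter> space M) =
      (\<integral>\<^sup>+x. ennreal (normal_density \<mu> s x) * indicator {a} x \<partial>lborel)"
    by (rule distributed_emeasure[OF X]) simp
  also have "\<dots> = (\<integral>\<^sup>+x. 0 \<partial>(lborel :: real measure))"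
  proof (rule nn_integral_cong_AE)
    show "AE x in lborel. ennreal (normal_density \<mu> s x) * indicator {a} x = 0"
      using AE_lborel_singleton[of a] by eventually_elim (auto simp: indicator_def)
  qed
  finally show ?thesis
    by (simp add: measure_def vimage_def Int_def conj_commute)
qed

lemma iid_centered_normal_measurable:
  assumes "iid_centered_normal M s e I" "i \<in> I"
  shows "e i \<in> borel_measurable M"
  using assms distributed_measurable[of M lborel "e i"] unfolding iid_centered_normal_def by auto

lemma (in prob_space) iid_centered_normal_sum:
  assumes iid: "iid_centered_normal M s e I" and "0 < s" "finite A" "A \<noteq> {}" "A \<subseteq> I"
  shows "distributed M lborel (\<lambda>\<omega>. \<Sum>i\<in>A. e i \<omega>) (normal_density 0 (s * sqrt (card A)))"
proof -
  have "distributed M lborel (\<lambda>x. \<Sum>i\<in>A. e i x)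
      (normal_density (\<Sum>i\<in>A. 0) (sqrt (\<Sum>i\<in>A. s\<^sup>2)))"
    using assms indep_vars_subset[of _ e I A]
    by (intro sum_indep_normal) (auto simp: iid_centered_normal_def)
  then show ?thesis
    using \<open>0 < s\<close> by (simp add: real_sqrt_mult mult.commute)
qed

text \<open>Measuring the threshold in units of the square root of the cardinality makes the bound
  independent of \<open>A\<close>, which is what a union bound over intervals of all lengths
  requires.\<close>

lemma (in prob_space) iid_centered_normal_sum_tail:
  assumes "iid_centered_normal M s e I" "0 < s" "finite A" "A \<noteq> {}" "A \<subseteq> I" "0 \<le> c"
  shows "prob {\<omega> \<in> space M. c * sqrt (card A) \<le> \<bar>\<Sum>i\<in>A. e i \<omega>\<bar>} \<le> 2 * exp (- (c\<^sup>2 / (2 * s\<^sup>2)))"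
proof -
  have "0 < card A" using assms by (simp add: card_gt_0_iff)
  then have "(c * sqrt (card A))\<^sup>2 / (2 * (s * sqrt (card A))\<^sup>2) = c\<^sup>2 / (2 * s\<^sup>2)"
    by (simp add: power_mult_distrib)
  then show ?thesis
    using normal_tail[OF iid_centered_normal_sum, of s e I A "c * sqrt (card A)"] assms \<open>0 < card A\<close>
    by simp
qed

lemma (in prob_space) indep_vars_reindex:
  assumes ind: "indep_vars M' X I" and inj: "inj_on f J" and sub: "f ` J \<subseteq> I"
  shows "indep_vars (M' \<circ> f) (X \<circ> f) J"
  unfolding indep_vars_def2
proof (intro conjI ballI indep_setsI)
  show "random_variable ((M' \<circ> f) j) ((X \<circ> f) j)" if "j \<in> J" for j
    using ind sub that by (auto simp: indep_vars_def2)
  then show "{(X \<circ> f) j -` A \<inter> space M |A. A \<in> sets ((M' \<circ> f) j)} \<subseteq> events" if "j \<in> J" for j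
    using that by auto
next
  fix A K assume K: "K \<noteq> {}" "K \<subseteq> J" "finite K"
    and A: "\<forall>j\<in>K. A j \<in> {(X \<circ> f) j -` A \<inter> space M |A. A \<in> sets ((M' \<circ> f) j)}"
  have injK: "inj_on f K" using inj K(2) by (rule inj_on_subset)
  have "prob (\<Inter>i\<in>f ` K. A (the_inv_into K f i)) = (\<Prod>i\<in>f ` K. prob (A (the_inv_into K f i)))"
  proof (rule indep_setsD)
    show "indep_sets (\<lambda>i. {X i -` A \<inter> space M |A. A \<in> sets (M' i)}) I"
      using ind by (simp add: indep_vars_def2)
    show "\<forall>i\<in>f ` K. A (the_inv_into K f i) \<in> {X i -` A \<inter> space M |A. A \<in> sets (M' i)}"
      using A injK by (simp add: the_inv_into_f_f)
  qed (use K sub in auto)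
  then show "prob (\<Inter> (A ` K)) = (\<Prod>j\<in>K. prob (A j))"
    using injK prod.reindex[OF injK, of "\<lambda>i. prob (A (the_inv_into K f i))"] by (simp add: the_inv_into_f_f)
qed

text \<open>Meant for \<open>f\<close> the inverse of the rank map: the noise at the off-grid
  indices, renumbered by rank and divided by the standard deviation, is standard noise on a block of
  integers.\<close>

lemma (in prob_space) iid_centered_normal_reindex:
  assumes iid: "iid_centered_normal M s e I" and "0 < s" and f: "inj_on f J" "f ` J \<subseteq> I"
  shows "iid_centered_normal M 1 (\<lambda>j \<omega>. e (f j) \<omega> / s) J"
proof -
  have "indep_vars (\<lambda>_. borel) (\<lambda>j. e (f j)) J"
    using indep_vars_reindex[OF _ f, of "\<lambda>_. borel" e] iid by (simp add: iid_centered_normal_def comp_def)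
  then have "indep_vars (\<lambda>_. borel) (\<lambda>j \<omega>. e (f j) \<omega> / s) J"
    by (rule indep_vars_compose2) simp
  moreover have "distributed M lborel (\<lambda>\<omega>. e (f j) \<omega> / s) (normal_density 0 1)" if "j \<in> J" for j
    using normal_standard_normal_convert[OF \<open>0 < s\<close>, of "e (f j)" 0] iid f that
    by (auto simp: iid_centered_normal_def)
  ultimately show ?thesis
    by (simp add: iid_centered_normal_def)
qed

text \<open>Independence makes both joint laws the same product of normal laws. This carries
  probabilities from the sample spaces, which change with N, to the space of the limit
  variable.\<close>

lemma iid_centered_normal_joint_law:
  fixes J :: "'i set"
  assumes "prob_space M" "prob_space P"
    and M: "iid_centered_normal M s e I" and P: "iid_centered_normal P s e' I'"
    and J: "J \<noteq> {}" "J \<subseteq> I" "J \<subseteq> I'"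
  shows "distr M (\<Pi>\<^sub>M j\<in>J. borel) (\<lambda>\<omega>. \<lambda>j\<in>J. e j \<omega>) = distr P (\<Pi>\<^sub>M j\<in>J. borel) (\<lambda>\<omega>. \<lambda>j\<in>J. e' j \<omega>)"
proof -
  have *: "distr Q (\<Pi>\<^sub>M j\<in>J. borel) (\<lambda>\<omega>. \<lambda>j\<in>J. u j \<omega>) = (\<Pi>\<^sub>M j\<in>J. density lborel (normal_density 0 s))"
    if "prob_space Q" "iid_centered_normal Q s u K" "J \<subseteq> K" for Q :: "'x measure" and u and K :: "'i set"
  proof -
    interpret prob_space Q by fact
    have "indep_vars (\<lambda>_. borel) u J"
      using that indep_vars_subset by (auto simp: iid_centered_normal_def)
    moreover have rv: "random_variable borel (u j)" if "j \<in> J" for j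
      using that \<open>J \<subseteq> K\<close> by (intro iid_centered_normal_measurable[OF \<open>iid_centered_normal Q s u K\<close>]) auto
    ultimately have "distr Q (\<Pi>\<^sub>M j\<in>J. borel) (\<lambda>\<omega>. \<lambda>j\<in>J. u j \<omega>) = (\<Pi>\<^sub>M j\<in>J. distr Q borel (u j))"
      using indep_vars_iff_distr_eq_PiM'[OF J(1), where M' = "\<lambda>_. borel" and X = u] by simp
    also have "\<dots> = (\<Pi>\<^sub>M j\<in>J. density lborel (normal_density 0 s))"
    proof (rule PiM_cong)
      fix j assume "j \<in> J"
      then have "distributed Q lborel (u j) (normal_density 0 s)"
        using that by (auto simp: iid_centered_normal_def)
      then show "distr Q borel (u j) = density lborel (normal_density 0 s)"
        by (metis distributed_distr_eq_density distr_cong sets_lborel)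
    qed simp
    finally show ?thesis .
  qed
  show ?thesis
    using *[OF assms(1) M J(2)] *[OF assms(2) P J(3)] by simp
qed

section \<open>The drift walk\<close>

text \<open>At least one of the two integer intervals is empty, so a single formula covers both
  directions and zero without case distinctions.\<close>

lemma drift_walk_alt:
  "drift_walk D e i = sgn D * ((\<Sum>j\<in>{1..i}. e j) - (\<Sum>j\<in>{i+1..0}. e j)) + real_of_int \<bar>i\<bar> * \<bar>D\<bar> / 2"
  by (auto simp: drift_walk_def)

lemma drift_walk_diff:
  assumes "i \<le> j"
  shows "drift_walk D e j - drift_walk D e i =
    sgn D * (\<Sum>m\<in>{i+1..j}. e m) + real_of_int (\<bar>j\<bar> - \<bar>i\<bar>) * \<bar>D\<bar> / 2"
proof -
  have eq: "(\<Sum>m\<in>{1..j}. e m) - (\<Sum>m\<in>{j+1..0}. e m) = (\<Sum>m\<in>{1..i}. e m) - (\<Sum>m\<in>{i+1..0}. e m) + (\<Sum>m\<in>{i+1..j}. e m)"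
  proof -
    consider "0 \<le> i" | "j \<le> 0" | "i < 0" "0 < j" by linarith
    then show ?thesis
    proof cases
      case 1
      then have "{1..j} = {1..i} \<union> {i+1..j}" using assms by auto
      then show ?thesis using 1 assms by (simp add: sum.union_disjoint)
    next
      case 2
      then have "{i+1..0} = {i+1..j} \<union> {j+1..0}" using assms by auto
      then show ?thesis using 2 assms by (simp add: sum.union_disjoint)
    next
      case 3
      then have "{i+1..j} = {i+1..0} \<union> {1..j}" by auto
      then show ?thesis using 3 by (simp add: sum.union_disjoint)
    qed
  qed
  show ?thesis
    unfolding drift_walk_alt eq by (simp add: algebra_simps add_divide_distrib diff_divide_distrib)
qed

lemma drift_walk_cong:
  assumes "\<And>j. j \<in> {1..i} \<union> {i+1..0} \<Longrightarrow> e j = e' j"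
  shows "drift_walk D e i = drift_walk D e' i"
  using assms by (simp add: drift_walk_alt)

lemma drift_walk_measurable:
  assumes "\<And>j. j \<in> {1..i} \<union> {i+1..0} \<Longrightarrow> (\<lambda>\<omega>. e j \<omega>) \<in> borel_measurable M"
  shows "(\<lambda>\<omega>. drift_walk D (\<lambda>j. e j \<omega>) i) \<in> borel_measurable M"
  unfolding drift_walk_alt using assms by measurable

text \<open>The walk has mean |m| * |D| / 2 at \<open>m\<close>. Falling to a quarter of it forces
  the sum of |m| noise terms to reach 3/8 * |m| * |D| in modulus. The weaker threshold |m| * |D| / 4
  equals \<open>c * sqrt (card A)\<close>, and c^2 / 2 = |m| * D^2 / 32 yields a bound geometric in
  |m|.\<close>

lemma (in prob_space) drift_walk_tail:
  assumes iid: "iid_centered_normal M 1 e I" and I: "{1..m} \<union> {m+1..0} \<subseteq> I" and "m \<noteq> 0"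
  shows "prob {\<omega> \<in> space M. drift_walk D (\<lambda>j. e j \<omega>) m \<le> real_of_int \<bar>m\<bar> * (\<bar>D\<bar> / 8)}
    \<le> 2 * exp (- (D\<^sup>2 / 32)) ^ nat \<bar>m\<bar>"
proof (cases "D = 0")
  case True
  then show ?thesis by (simp add: order_trans[OF prob_le_1])
next
  case False
  define A where "A = {1..m} \<union> {m+1..0}"
  define c where "c = \<bar>D\<bar> / 4 * sqrt \<bar>m\<bar>"
  have A: "finite A" "A \<noteq> {}" "A \<subseteq> I" "real (card A) = \<bar>m\<bar>"
    using \<open>m \<noteq> 0\<close> I by (auto simp: A_def card_Un_disjoint)
  have [measurable]: "e i \<in> borel_measurable M" if "i \<in> A" for i
    using iid_centered_normal_measurable[OF iid] that A by auto
  have c: "c * sqrt (card A) = \<bar>D\<bar> / 4 * real_of_int \<bar>m\<bar>" "c\<^sup>2 = D\<^sup>2 / 16 * \<bar>m\<bar>" "0 \<le> c"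
    unfolding A c_def by (simp_all add: power_mult_distrib power_divide)
  have "prob {\<omega> \<in> space M. drift_walk D (\<lambda>j. e j \<omega>) m \<le> real_of_int \<bar>m\<bar> * (\<bar>D\<bar> / 8)}
      \<le> prob {\<omega> \<in> space M. c * sqrt (card A) \<le> \<bar>\<Sum>i\<in>A. e i \<omega>\<bar>}"
  proof (intro finite_measure_mono subsetI)
    fix \<omega> assume "\<omega> \<in> {\<omega> \<in> space M. drift_walk D (\<lambda>j. e j \<omega>) m \<le> real_of_int \<bar>m\<bar> * (\<bar>D\<bar> / 8)}"
    then have *: "\<omega> \<in> space M" "drift_walk D (\<lambda>j. e j \<omega>) m \<le> real_of_int \<bar>m\<bar> * (\<bar>D\<bar> / 8)" by auto
    have "- \<bar>\<Sum>i\<in>A. e i \<omega>\<bar> + real_of_int \<bar>m\<bar> * \<bar>D\<bar> / 2 \<le> drift_walk D (\<lambda>j. e j \<omega>) m"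
    proof (cases "m > 0")
      case True
      then show ?thesis using False by (auto simp: A_def drift_walk_alt sgn_real_def)
    next
      assume "\<not> m > 0"
      then show ?thesis using False by (auto simp: A_def drift_walk_alt sgn_real_def)
    qed
    with * have "- \<bar>\<Sum>i\<in>A. e i \<omega>\<bar> + real_of_int \<bar>m\<bar> * \<bar>D\<bar> / 2 \<le> real_of_int \<bar>m\<bar> * (\<bar>D\<bar> / 8)" by linarith
    moreover have "0 \<le> real_of_int \<bar>m\<bar> * \<bar>D\<bar>" by simp
    ultimately have "c * sqrt (card A) \<le> \<bar>\<Sum>i\<in>A. e i \<omega>\<bar>"
      unfolding c by (simp add: algebra_simps)
    then show "\<omega> \<in> {\<omega> \<in> space M. c * sqrt (card A) \<le> \<bar>\<Sum>i\<in>A. e i \<omega>\<bar>}" using * by simp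
  qed measurable
  also have "\<dots> \<le> 2 * exp (- (c\<^sup>2 / (2 * 1\<^sup>2)))"
    by (rule iid_centered_normal_sum_tail[OF iid]) (use A c in auto)
  also have "\<dots> = 2 * exp (- (D\<^sup>2 / 32)) ^ nat \<bar>m\<bar>"
    by (simp add: c exp_of_nat_mult[symmetric])
  finally show ?thesis .
qed

lemma sum_power_abs_le:
  fixes r :: real and S :: "int set"
  assumes r: "0 \<le> r" "r < 1" and S: "finite S" "\<And>m. m \<in> S \<Longrightarrow> int b \<le> \<bar>m\<bar>"
  shows "(\<Sum>m\<in>S. r ^ nat \<bar>m\<bar>) \<le> 2 * (r ^ b / (1 - r))"
proof -
  obtain K where K: "\<And>m. m \<in> S \<Longrightarrow> nat \<bar>m\<bar> \<le> K"
    using finite_nat_set_iff_bounded_le[of "(\<lambda>m. nat \<bar>m\<bar>) ` S"] S(1) by auto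
  have "(\<Sum>n\<in>{b..K}. r ^ n) = r ^ b * (\<Sum>n\<in>{..<Suc K - b}. r ^ n)"
    unfolding sum_distrib_left power_add[symmetric]
    by (rule sum.reindex_bij_witness[of _ "\<lambda>n. b + n" "\<lambda>n. n - b"]) auto
  also have "\<dots> \<le> r ^ b * (1 / (1 - r))"
    using r sum_le_suminf[of "\<lambda>n. r ^ n" "{..<Suc K - b}"]
    by (intro mult_left_mono) (simp_all add: summable_geometric suminf_geometric)
  finally have geo: "(\<Sum>n\<in>{b..K}. r ^ n) \<le> r ^ b / (1 - r)" by simp
  have "S \<subseteq> int ` {b..K} \<union> (\<lambda>n. - int n) ` {b..K}"
  proof
    fix m assume m: "m \<in> S"
    then have "nat \<bar>m\<bar> \<in> {b..K}" using K[OF m] S(2)[OF m] by auto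
    moreover have "m = int (nat \<bar>m\<bar>) \<or> m = - int (nat \<bar>m\<bar>)" by auto
    ultimately show "m \<in> int ` {b..K} \<union> (\<lambda>n. - int n) ` {b..K}" by blast
  qed
  then have "(\<Sum>m\<in>S. r ^ nat \<bar>m\<bar>) \<le> (\<Sum>m\<in>int ` {b..K} \<union> (\<lambda>n. - int n) ` {b..K}. r ^ nat \<bar>m\<bar>)"
    using r by (intro sum_mono2) auto
  \<comment> \<open>The two images can share the element 0; the inclusion-exclusion correction is
    nonnegative and is dropped.\<close>
  also have "\<dots> \<le> (\<Sum>m\<in>int ` {b..K}. r ^ nat \<bar>m\<bar>) + (\<Sum>m\<in>(\<lambda>n. - int n) ` {b..K}. r ^ nat \<bar>m\<bar>)"
    using r sum_nonneg[of "int ` {b..K} \<inter> (\<lambda>n. - int n) ` {b..K}" "\<lambda>m. r ^ nat \<bar>m\<bar>"]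
    by (simp add: sum_Un)
  also have "\<dots> = 2 * (\<Sum>n\<in>{b..K}. r ^ n)"
    by (simp add: sum.reindex inj_on_def)
  finally show ?thesis using geo by linarith
qed

text \<open>A union bound over ranks with a geometric tail. The level |m| * |D| / 8 in place of 0
  leaves room for an error linear in the rank. The conditions on \<open>a\<close> and
  \<open>b\<close> ensure that the walk at any rank in \<open>{a..b}\<close> uses only noise indexed
  there.\<close>

lemma (in prob_space) drift_walk_tightness:
  assumes iid: "iid_centered_normal M 1 e {a..b}" and ab: "a \<le> 1" "0 \<le> b" and D: "D \<noteq> 0"
  shows "prob {\<omega> \<in> space M. \<exists>m\<in>{a..b}. int (Suc B) \<le> \<bar>m\<bar> \<and>
      drift_walk D (\<lambda>j. e j \<omega>) m \<le> real_of_int \<bar>m\<bar> * (\<bar>D\<bar> / 8)}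
    \<le> 4 * (exp (- (D\<^sup>2 / 32)) ^ Suc B / (1 - exp (- (D\<^sup>2 / 32))))" (is "prob ?E \<le> _")
proof -
  define S where "S = {m\<in>{a..b}. int (Suc B) \<le> \<bar>m\<bar>}"
  let ?E' = "\<lambda>m. {\<omega> \<in> space M. drift_walk D (\<lambda>j. e j \<omega>) m \<le> real_of_int \<bar>m\<bar> * (\<bar>D\<bar> / 8)}"
  have meas: "(\<lambda>\<omega>. drift_walk D (\<lambda>j. e j \<omega>) m) \<in> borel_measurable M" if "m \<in> S" for m
    using that ab by (intro drift_walk_measurable iid_centered_normal_measurable[OF iid]) (auto simp: S_def)
  have finS: "finite S"
    by (rule finite_subset[of S "{a..b}"]) (auto simp: S_def)
  have "?E = (\<Union>m\<in>S. ?E' m)" by (auto simp: S_def)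
  also have "prob \<dots> \<le> (\<Sum>m\<in>S. prob (?E' m))"
    using meas finS by (intro measure_UNION_le) measurable
  also have "\<dots> \<le> (\<Sum>m\<in>S. 2 * exp (- (D\<^sup>2 / 32)) ^ nat \<bar>m\<bar>)"
    using ab by (intro sum_mono drift_walk_tail[OF iid]) (auto simp: S_def)
  also have "\<dots> = 2 * (\<Sum>m\<in>S. exp (- (D\<^sup>2 / 32)) ^ nat \<bar>m\<bar>)"
    by (simp add: sum_distrib_left)
  also have "\<dots> \<le> 2 * (2 * (exp (- (D\<^sup>2 / 32)) ^ Suc B / (1 - exp (- (D\<^sup>2 / 32)))))"
    using D by (intro mult_left_mono sum_power_abs_le[OF _ _ finS]) (auto simp: S_def)
  finally show ?thesis by simp
qed

text \<open>Tightness keeps nearly all mass in a finite set, and the upper bounds limit what the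
  points other than \<open>l\<close> can take of it. What is left for \<open>l\<close> is at least
  one minus the limiting mass of those points, hence at least \<open>p l\<close>, up to the
  error.\<close>

lemma tendsto_from_upper_bounds:
  fixes f :: "nat \<Rightarrow> 'i \<Rightarrow> real" and p :: "'i \<Rightarrow> real"
  assumes upper: "\<And>l \<eta>. 0 < \<eta> \<Longrightarrow> \<forall>\<^sub>F N in sequentially. f N l \<le> p l + \<eta>"
    and tight: "\<And>\<eta>. 0 < \<eta> \<Longrightarrow> \<exists>F. finite F \<and> (\<forall>\<^sub>F N in sequentially. 1 - \<eta> \<le> (\<Sum>l\<in>F. f N l))"
    and nonneg: "\<And>N l. 0 \<le> f N l"
    and mass: "\<And>F. finite F \<Longrightarrow> (\<Sum>l\<in>F. p l) \<le> 1"
  shows "(\<lambda>N. f N l) \<longlonglongrightarrow> p l"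
proof (rule tendstoI)
  fix \<eta> :: real assume "0 < \<eta>"
  obtain F where F: "finite F" "\<forall>\<^sub>F N in sequentially. 1 - \<eta> / 4 \<le> (\<Sum>l\<in>F. f N l)"
    using tight[of "\<eta> / 4"] \<open>0 < \<eta>\<close> by auto
  define G where "G = insert l F - {l}"
  have G: "finite G" "insert l F = insert l G" "l \<notin> G" using F by (auto simp: G_def)
  \<comment> \<open>Spreads an error of \<open>\<eta> / 4\<close> over the points of
    \<open>G\<close>; the added 1 covers empty \<open>G\<close>.\<close>
  define \<zeta> where "\<zeta> = \<eta> / (4 * (real (card G) + 1))"
  have "0 < \<zeta>" using \<open>0 < \<eta>\<close> by (simp add: \<zeta>_def)
  have z: "card G * \<zeta> \<le> \<eta> / 4"
    using \<open>0 < \<eta>\<close> by (simp add: \<zeta>_def field_simps)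
  have "\<forall>\<^sub>F N in sequentially. \<forall>j\<in>G. f N j \<le> p j + \<zeta>"
    using G upper[OF \<open>0 < \<zeta>\<close>] by (intro eventually_ball_finite) auto
  then show "\<forall>\<^sub>F N in sequentially. dist (f N l) (p l) < \<eta>"
    using F(2) upper[OF half_gt_zero[OF \<open>0 < \<eta>\<close>], of l]
  proof eventually_elim
    case (elim N)
    have "1 - \<eta> / 4 \<le> (\<Sum>l\<in>insert l F. f N l)"
      using elim(2) sum_mono2[of "insert l F" F "f N"] F nonneg by fastforce
    then have "1 - \<eta> / 4 \<le> f N l + (\<Sum>j\<in>G. f N j)"
      using G by simp
    moreover have "(\<Sum>j\<in>G. f N j) \<le> (\<Sum>j\<in>G. p j + \<zeta>)"
      using elim(1) by (intro sum_mono) auto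
    moreover have "p l + (\<Sum>j\<in>G. p j) \<le> 1"
      using mass[of "insert l G"] G by simp
    ultimately show ?case
      using elim(3) z \<open>0 < \<eta>\<close> by (simp add: sum.distrib dist_real_def abs_if)
  qed
qed

text \<open>A tie between \<open>i < j\<close> pins a nondegenerate Gaussian sum to the single value
  \<open>c\<close>, which has probability zero, and there are countably many pairs. Hence the
  limiting walk almost surely has at most one minimizer.\<close>

lemma (in prob_space) drift_walk_inj_AE:
  assumes iid: "iid_centered_normal M 1 e UNIV" and D: "D \<noteq> 0"
  shows "AE \<omega> in M. inj (drift_walk D (\<lambda>j. e j \<omega>))"
proof -
  have [measurable]: "e i \<in> borel_measurable M" for i
    using iid_centered_normal_measurable[OF iid] by simp
  have ne: "AE \<omega> in M. drift_walk D (\<lambda>j. e j \<omega>) i \<noteq> drift_walk D (\<lambda>j. e j \<omega>) j" if "i < j" for i j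
  proof -
    define c where "c = - (real_of_int (\<bar>j\<bar> - \<bar>i\<bar>) * \<bar>D\<bar> / 2) / sgn D"
    have "distributed M lborel (\<lambda>\<omega>. \<Sum>m\<in>{i+1..j}. e m \<omega>) (normal_density 0 (1 * sqrt (card {i+1..j})))"
      using that by (intro iid_centered_normal_sum[OF iid]) auto
    then have "prob {\<omega> \<in> space M. (\<Sum>m\<in>{i+1..j}. e m \<omega>) = c} = 0"
      by (rule normal_point_null)
    then have "AE \<omega> in M. (\<Sum>m\<in>{i+1..j}. e m \<omega>) \<noteq> c"
      by (subst (asm) prob_eq_0) auto
    then show ?thesis
    proof eventually_elim
      case (elim \<omega>)
      then show ?case
        using drift_walk_diff[of i j D "\<lambda>j. e j \<omega>"] that D by (cases "0 < D") (auto simp: c_def field_simps)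
    qed
  qed
  have "AE \<omega> in M. \<forall>i j. i < j \<longrightarrow> drift_walk D (\<lambda>j. e j \<omega>) i \<noteq> drift_walk D (\<lambda>j. e j \<omega>) j"
    unfolding AE_all_countable using ne by auto
  then show ?thesis
    by eventually_elim (metis injI linorder_neqE)
qed

text \<open>Widening the window and shrinking the slack gives a decreasing sequence of events whose
  intersection says that \<open>l\<close> is a global minimizer. By almost sure injectivity this is
  \<open>L = l\<close> up to a null set. The slack is what later absorbs the gap between loss and
  walk.\<close>

lemma drift_walk_near_min_limit:
  assumes "prob_space P" and iid: "iid_centered_normal P 1 e UNIV" and D: "D \<noteq> 0"
    and L: "argmin_drift_walk P D e L"
  shows "(\<lambda>n. measure P {\<omega> \<in> space P. \<forall>i\<in>{- int n..int n}.
      drift_walk D (\<lambda>j. e j \<omega>) l \<le> drift_walk D (\<lambda>j. e j \<omega>) i + 1 / real (Suc n)})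
    \<longlonglongrightarrow> measure P {\<omega> \<in> space P. L \<omega> = l}"
proof -
  interpret prob_space P by fact
  let ?X = "\<lambda>\<omega>. drift_walk D (\<lambda>j. e j \<omega>)"
  define V where "V n = {\<omega> \<in> space P. \<forall>i\<in>{- int n..int n}. ?X \<omega> l \<le> ?X \<omega> i + 1 / real (Suc n)}" for n
  have [measurable]: "(\<lambda>\<omega>. ?X \<omega> i) \<in> borel_measurable P" for i
    by (intro drift_walk_measurable iid_centered_normal_measurable[OF iid]) auto
  have [measurable]: "L \<in> measurable P (count_space UNIV)"
    using L by (simp add: argmin_drift_walk_def)
  have V: "V n \<in> events" for n unfolding V_def by measurable
  have "decseq V"
  proof (rule decseq_SucI, rule subsetI)
    fix n \<omega> assume \<omega>: "\<omega> \<in> V (Suc n)"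
    have "?X \<omega> l \<le> ?X \<omega> i + 1 / real (Suc n)" if "i \<in> {- int n..int n}" for i
    proof -
      have "?X \<omega> l \<le> ?X \<omega> i + 1 / real (Suc (Suc n))" using \<omega> that by (auto simp: V_def)
      also have "1 / real (Suc (Suc n)) \<le> 1 / real (Suc n)" by (intro divide_left_mono) auto
      finally show ?thesis by simp
    qed
    then show "\<omega> \<in> V n" using \<omega> by (auto simp: V_def)
  qed
  then have "(\<lambda>n. prob (V n)) \<longlonglongrightarrow> prob (\<Inter>n. V n)"
    using V by (intro finite_Lim_measure_decseq) auto
  also have "(\<Inter>n. V n) = {\<omega> \<in> space P. \<forall>i. ?X \<omega> l \<le> ?X \<omega> i}"
  proof (intro set_eqI iffI)
    fix \<omega> assume \<omega>: "\<omega> \<in> (\<Inter>n. V n)"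
    have "?X \<omega> l \<le> ?X \<omega> i" for i
    proof (rule field_le_epsilon)
      fix \<zeta> :: real assume "0 < \<zeta>"
      then obtain n0 where n0: "1 / real (Suc n0) < \<zeta>" using nat_approx_posE by metis
      \<comment> \<open>Large enough both for the slack to fall below \<open>\<zeta>\<close> and for
        the window to contain \<open>i\<close>.\<close>
      define n where "n = max n0 (nat \<bar>i\<bar>)"
      have "?X \<omega> l \<le> ?X \<omega> i + 1 / real (Suc n)" using \<omega> by (force simp: V_def n_def)
      moreover have "1 / real (Suc n) \<le> 1 / real (Suc n0)" by (intro divide_left_mono) (auto simp: n_def)
      ultimately show "?X \<omega> l \<le> ?X \<omega> i + \<zeta>" using n0 by linarith
    qed
    then show "\<omega> \<in> {\<omega> \<in> space P. \<forall>i. ?X \<omega> l \<le> ?X \<omega> i}" using \<omega> by (auto simp: V_def)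
  next
    fix \<omega> assume "\<omega> \<in> {\<omega> \<in> space P. \<forall>i. ?X \<omega> l \<le> ?X \<omega> i}"
    then show "\<omega> \<in> (\<Inter>n. V n)" by (auto simp: V_def intro: add_increasing2)
  qed
  also have "prob \<dots> = prob {\<omega> \<in> space P. L \<omega> = l}"
  proof (rule finite_measure_eq_AE)
    have "AE \<omega> in P. is_arg_min (?X \<omega>) (\<lambda>_. True) (L \<omega>)"
      using L by (simp add: argmin_drift_walk_def)
    then show "AE \<omega> in P. (\<omega> \<in> {\<omega> \<in> space P. \<forall>i. ?X \<omega> l \<le> ?X \<omega> i}) = (\<omega> \<in> {\<omega> \<in> space P. L \<omega> = l})"
      using drift_walk_inj_AE[OF iid D]
    proof eventually_elim
      case (elim \<omega>)
      then have "?X \<omega> (L \<omega>) \<le> ?X \<omega> i" for i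
        by (auto simp: is_arg_min_def not_less)
      moreover have "L \<omega> = l" if "?X \<omega> l \<le> ?X \<omega> (L \<omega>)"
        using that calculation[of l] elim(2) by (auto dest: injD)
      ultimately show ?case by auto
    qed
  qed measurable
  finally show ?thesis by (simp only: V_def)
qed

text \<open>The walk at a rank uses only noise between that rank and zero, so the event is a set of
  noise vectors indexed by the window. Its probability therefore agrees exactly with that in the
  limit model as soon as \<open>I\<close> contains the window.\<close>

lemma drift_walk_near_min_law:
  assumes "prob_space M" "prob_space P"
    and M: "iid_centered_normal M 1 \<xi> I" and P: "iid_centered_normal P 1 e UNIV"
    and n: "{- int n..int n} \<subseteq> I" "l \<in> {- int n..int n}"
  shows "{\<omega> \<in> space M. \<forall>i\<in>{- int n..int n}.
      drift_walk D (\<lambda>j. \<xi> j \<omega>) l \<le> drift_walk D (\<lambda>j. \<xi> j \<omega>) i + c} \<in> sets M" (is "?VM \<in> _")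
    and "measure M {\<omega> \<in> space M. \<forall>i\<in>{- int n..int n}.
      drift_walk D (\<lambda>j. \<xi> j \<omega>) l \<le> drift_walk D (\<lambda>j. \<xi> j \<omega>) i + c} =
     measure P {\<omega> \<in> space P. \<forall>i\<in>{- int n..int n}.
      drift_walk D (\<lambda>j. e j \<omega>) l \<le> drift_walk D (\<lambda>j. e j \<omega>) i + c}" (is "_ = measure P ?VP")
proof -
  define J where "J = {- int n..int n}"
  define T where "T = {x \<in> space (\<Pi>\<^sub>M j\<in>J. (borel :: real measure)). \<forall>i\<in>J. drift_walk D x l \<le> drift_walk D x i + c}"
  have "(\<lambda>x. drift_walk D (\<lambda>j. x j) i) \<in> borel_measurable (\<Pi>\<^sub>M j\<in>J. (borel :: real measure))" if "i \<in> J" for i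
    using that by (intro drift_walk_measurable measurable_component_singleton) (auto simp: J_def)
  moreover have "l \<in> J" "finite J" using n by (auto simp: J_def)
  ultimately have T: "T \<in> sets (\<Pi>\<^sub>M j\<in>J. (borel :: real measure))"
    unfolding T_def by (intro sets.sets_Collect_finite_All borel_measurable_le) auto
  have V: "{\<omega> \<in> space Q. \<forall>i\<in>{- int n..int n}.
      drift_walk D (\<lambda>j. u j \<omega>) l \<le> drift_walk D (\<lambda>j. u j \<omega>) i + c} = (\<lambda>\<omega>. \<lambda>j\<in>J. u j \<omega>) -` T \<inter> space Q"
    for Q :: "'q measure" and u :: "int \<Rightarrow> 'q \<Rightarrow> real"
  proof -
    have "drift_walk D (\<lambda>j\<in>J. u j \<omega>) i = drift_walk D (\<lambda>j. u j \<omega>) i" if "i \<in> J" for i \<omega>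
      using that by (intro drift_walk_cong) (auto simp: J_def)
    with \<open>l \<in> J\<close> show ?thesis
      by (auto simp: T_def J_def[symmetric] space_PiM)
  qed
  have rv: "(\<lambda>\<omega>. \<lambda>j\<in>J. u j \<omega>) \<in> measurable Q (\<Pi>\<^sub>M j\<in>J. borel)"
    if "iid_centered_normal Q 1 u K" "J \<subseteq> K" for Q :: "'q measure" and u and K
    using that by (intro measurable_restrict iid_centered_normal_measurable[OF that(1)]) auto
  have JI: "J \<subseteq> I" using n by (simp add: J_def)
  show "?VM \<in> sets M"
    unfolding V using measurable_sets[OF rv[OF M JI] T] .
  have "distr M (\<Pi>\<^sub>M j\<in>J. borel) (\<lambda>\<omega>. \<lambda>j\<in>J. \<xi> j \<omega>) = distr P (\<Pi>\<^sub>M j\<in>J. borel) (\<lambda>\<omega>. \<lambda>j\<in>J. e j \<omega>)"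
    using \<open>l \<in> J\<close> by (intro iid_centered_normal_joint_law[OF assms(1,2) M P _ JI]) auto
  then have "measure (distr M (\<Pi>\<^sub>M j\<in>J. borel) (\<lambda>\<omega>. \<lambda>j\<in>J. \<xi> j \<omega>)) T =
      measure (distr P (\<Pi>\<^sub>M j\<in>J. borel) (\<lambda>\<omega>. \<lambda>j\<in>J. e j \<omega>)) T" by simp
  then show "measure M ?VM = measure P ?VP"
    unfolding V using measure_distr[OF rv[OF M JI] T] measure_distr[OF rv[OF P] T] by simp
qed

section \<open>Convergence of near-minimizers of the drift walk\<close>

text \<open>The hypothesis \<open>near\<close> is used twice: on a fixed window its linear error is
  at most the slack of the near-minimum event, which gives the upper bounds; comparison with rank
  zero alone, where the walk is 0, gives tightness.\<close>

lemma argmin_walk_limit: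
  fixes M :: "nat \<Rightarrow> 'a measure" and \<xi> :: "nat \<Rightarrow> int \<Rightarrow> 'a \<Rightarrow> real" and \<Lambda> :: "nat \<Rightarrow> 'a \<Rightarrow> int"
  assumes M: "\<And>N. prob_space (M N)" and "prob_space P" and D: "D \<noteq> 0"
    and iid: "\<forall>\<^sub>F N in sequentially. iid_centered_normal (M N) 1 (\<xi> N) {lo N..hi N}"
    and range: "\<And>B. \<forall>\<^sub>F N in sequentially. {- int B..int B} \<subseteq> {lo N..hi N}"
    and meas: "\<And>N. \<Lambda> N \<in> measurable (M N) (count_space UNIV)"
    and near: "\<And>B \<eta>. 0 < \<eta> \<Longrightarrow> \<forall>\<^sub>F N in sequentially. \<exists>A\<in>sets (M N). measure (M N) A \<le> \<eta> \<and>
      (AE \<omega> in M N. \<omega> \<notin> A \<longrightarrow> \<Lambda> N \<omega> \<in> {lo N..hi N} \<and>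
        (\<forall>i\<in>{- int B..int B}. drift_walk D (\<lambda>j. \<xi> N j \<omega>) (\<Lambda> N \<omega>)
          \<le> drift_walk D (\<lambda>j. \<xi> N j \<omega>) i + real_of_int (\<bar>\<Lambda> N \<omega>\<bar> + \<bar>i\<bar>) * \<eta>))"
    and e: "iid_centered_normal P 1 e UNIV" and L: "argmin_drift_walk P D e L"
  shows "(\<lambda>N. measure (M N) {\<omega> \<in> space (M N). \<Lambda> N \<omega> = l}) \<longlonglongrightarrow> measure P {\<omega> \<in> space P. L \<omega> = l}"
proof (rule tendsto_from_upper_bounds[where f = "\<lambda>N l. measure (M N) {\<omega> \<in> space (M N). \<Lambda> N \<omega> = l}"
      and p = "\<lambda>l. measure P {\<omega> \<in> space P. L \<omega> = l}"])
  let ?X = "\<lambda>N \<omega>. drift_walk D (\<lambda>j. \<xi> N j \<omega>)"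
  interpret P: prob_space P by fact
  have [measurable]: "L \<in> measurable P (count_space UNIV)"
    using L by (simp add: argmin_drift_walk_def)
  note [measurable] = meas
  show "0 \<le> measure (M N) {\<omega> \<in> space (M N). \<Lambda> N \<omega> = l}" for N l by simp
  show "(\<Sum>l\<in>F. P.prob {\<omega> \<in> space P. L \<omega> = l}) \<le> 1" if "finite F" for F
  proof -
    have "(\<Sum>l\<in>F. P.prob {\<omega> \<in> space P. L \<omega> = l}) = P.prob (\<Union>l\<in>F. {\<omega> \<in> space P. L \<omega> = l})"
      using that by (intro P.finite_measure_finite_Union[symmetric]) (auto simp: disjoint_family_on_def)
    then show ?thesis by simp
  qed
  show "\<forall>\<^sub>F N in sequentially. measure (M N) {\<omega> \<in> space (M N). \<Lambda> N \<omega> = l} \<le> P.prob {\<omega> \<in> space P. L \<omega> = l} + \<eta>"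
    if "0 < \<eta>" for l \<eta>
  proof -
    have "\<forall>\<^sub>F n in sequentially. P.prob {\<omega> \<in> space P. \<forall>i\<in>{- int n..int n}.
        drift_walk D (\<lambda>j. e j \<omega>) l \<le> drift_walk D (\<lambda>j. e j \<omega>) i + 1 / real (Suc n)}
        < P.prob {\<omega> \<in> space P. L \<omega> = l} + \<eta> / 2"
      using drift_walk_near_min_limit[OF \<open>prob_space P\<close> e D L, of l] that by (intro order_tendstoD) auto
    moreover have "\<forall>\<^sub>F n in sequentially. nat \<bar>l\<bar> \<le> n" by (rule eventually_ge_at_top)
    ultimately obtain n where n: "nat \<bar>l\<bar> \<le> n"
      "P.prob {\<omega> \<in> space P. \<forall>i\<in>{- int n..int n}.
        drift_walk D (\<lambda>j. e j \<omega>) l \<le> drift_walk D (\<lambda>j. e j \<omega>) i + 1 / real (Suc n)}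
        < P.prob {\<omega> \<in> space P. L \<omega> = l} + \<eta> / 2"
      using eventually_conj eventually_happens'[OF sequentially_bot] by (metis (no_types, lifting))
    \<comment> \<open>The first entry bounds the exceptional probability. The second makes the
      error, at most 2 * n * \<open>\<zeta>\<close> on the window, smaller than the slack; adding 1
      keeps the denominator positive for n = 0.\<close>
    define \<zeta> where "\<zeta> = min (\<eta> / 2) (1 / (real (Suc n) * (2 * real n + 1)))"
    have "0 < \<zeta>" using that by (simp add: \<zeta>_def)
    have ln: "l \<in> {- int n..int n}" using n by auto
    show ?thesis
      using near[OF \<open>0 < \<zeta>\<close>, of n] iid range[of n]
    proof eventually_elim
      case (elim N)
      interpret N: prob_space "M N" by (rule M)
      obtain A where A: "A \<in> sets (M N)" "N.prob A \<le> \<zeta>"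
        and near_A: "AE \<omega> in M N. \<omega> \<notin> A \<longrightarrow> \<Lambda> N \<omega> \<in> {lo N..hi N} \<and>
        (\<forall>i\<in>{- int n..int n}. ?X N \<omega> (\<Lambda> N \<omega>) \<le> ?X N \<omega> i + real_of_int (\<bar>\<Lambda> N \<omega>\<bar> + \<bar>i\<bar>) * \<zeta>)"
        using elim(1) by blast
      define V where "V = {\<omega> \<in> space (M N). \<forall>i\<in>{- int n..int n}. ?X N \<omega> l \<le> ?X N \<omega> i + 1 / real (Suc n)}"
      note law = drift_walk_near_min_law[OF M \<open>prob_space P\<close> elim(2) e elim(3) ln, of D "1 / real (Suc n)", folded V_def]
      have "AE \<omega> in M N. \<omega> \<in> {\<omega> \<in> space (M N). \<Lambda> N \<omega> = l} \<longrightarrow> \<omega> \<in> A \<union> V"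
        using near_A
      proof (eventually_elim, intro impI)
        fix \<omega>
        assume *: "\<omega> \<notin> A \<longrightarrow> \<Lambda> N \<omega> \<in> {lo N..hi N} \<and>
            (\<forall>i\<in>{- int n..int n}. ?X N \<omega> (\<Lambda> N \<omega>) \<le> ?X N \<omega> i + real_of_int (\<bar>\<Lambda> N \<omega>\<bar> + \<bar>i\<bar>) * \<zeta>)"
          and \<omega>: "\<omega> \<in> {\<omega> \<in> space (M N). \<Lambda> N \<omega> = l}"
        show "\<omega> \<in> A \<union> V"
        proof (cases "\<omega> \<in> A")
          case False
          have "?X N \<omega> l \<le> ?X N \<omega> i + 1 / real (Suc n)" if i: "i \<in> {- int n..int n}" for i
          proof -
            have "?X N \<omega> l \<le> ?X N \<omega> i + real_of_int (\<bar>l\<bar> + \<bar>i\<bar>) * \<zeta>"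
              using * False \<omega> i by auto
            moreover have "real_of_int (\<bar>l\<bar> + \<bar>i\<bar>) * \<zeta> \<le> (2 * real n + 1) * (1 / (real (Suc n) * (2 * real n + 1)))"
              using i ln \<open>0 < \<zeta>\<close> by (intro mult_mono) (auto simp: \<zeta>_def)
            moreover have "\<dots> = 1 / real (Suc n)" by simp
            ultimately show ?thesis by linarith
          qed
          then show ?thesis using \<omega> by (auto simp: V_def)
        qed simp
      qed
      then have "N.prob {\<omega> \<in> space (M N). \<Lambda> N \<omega> = l} \<le> N.prob (A \<union> V)"
        using A(1) law(1) by (intro N.finite_measure_mono_AE) auto
      also have "\<dots> \<le> N.prob A + N.prob V"
        using A(1) law(1) by (intro measure_Un_le)
      finally show ?case
        using A(2) n(2) law(2) by (simp add: \<zeta>_def)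
    qed
  qed
  show "\<exists>F. finite F \<and> (\<forall>\<^sub>F N in sequentially. 1 - \<eta> \<le> (\<Sum>l\<in>F. measure (M N) {\<omega> \<in> space (M N). \<Lambda> N \<omega> = l}))"
    if "0 < \<eta>" for \<eta>
  proof -
    define r where "r = exp (- (D\<^sup>2 / 32))"
    have r: "0 < r" "r < 1" using D by (auto simp: r_def)
    have "(\<lambda>n. 4 * (r ^ Suc n / (1 - r))) \<longlonglongrightarrow> 4 * (0 / (1 - r))"
      using r by (intro tendsto_intros LIMSEQ_Suc LIMSEQ_realpow_zero) auto
    then have "\<forall>\<^sub>F n in sequentially. 4 * (r ^ Suc n / (1 - r)) < \<eta> / 2"
      using that by (intro order_tendstoD) auto
    then obtain B where B: "4 * (r ^ Suc B / (1 - r)) < \<eta> / 2"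
      using eventually_happens'[OF sequentially_bot] by blast
    \<comment> \<open>With coefficient at most |D| / 8, a near-minimizer of large rank meets the
      level in \<open>drift_walk_tightness\<close>. Comparing with rank zero suffices, hence the
      window \<open>0\<close> in \<open>near\<close>.\<close>
    define \<zeta> where "\<zeta> = min (\<eta> / 2) (\<bar>D\<bar> / 8)"
    have "0 < \<zeta>" using that D by (simp add: \<zeta>_def)
    have "\<forall>\<^sub>F N in sequentially. 1 - \<eta> \<le> (\<Sum>l\<in>{- int B..int B}. measure (M N) {\<omega> \<in> space (M N). \<Lambda> N \<omega> = l})"
      using near[OF \<open>0 < \<zeta>\<close>, of 0] iid range[of B]
    proof eventually_elim
      case (elim N)
      interpret N: prob_space "M N" by (rule M)
      obtain A where A: "A \<in> sets (M N)" "N.prob A \<le> \<zeta>"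
        and near_A: "AE \<omega> in M N. \<omega> \<notin> A \<longrightarrow> \<Lambda> N \<omega> \<in> {lo N..hi N} \<and>
        (\<forall>i\<in>{- int 0..int 0}. ?X N \<omega> (\<Lambda> N \<omega>) \<le> ?X N \<omega> i + real_of_int (\<bar>\<Lambda> N \<omega>\<bar> + \<bar>i\<bar>) * \<zeta>)"
        using elim(1) by blast
      have ab: "lo N \<le> 1" "0 \<le> hi N" using elim(3) by auto
      define E where "E = {\<omega> \<in> space (M N). \<exists>m\<in>{lo N..hi N}. int (Suc B) \<le> \<bar>m\<bar> \<and>
          ?X N \<omega> m \<le> real_of_int \<bar>m\<bar> * (\<bar>D\<bar> / 8)}"
      have "N.prob E \<le> 4 * (r ^ Suc B / (1 - r))"
        using N.drift_walk_tightness[OF elim(2) ab D, of B] by (simp only: E_def r_def)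
      then have E: "N.prob E \<le> \<eta> / 2" using B by simp
      have "(\<lambda>\<omega>. ?X N \<omega> m) \<in> borel_measurable (M N)" if "m \<in> {lo N..hi N}" for m
        using that ab by (intro drift_walk_measurable iid_centered_normal_measurable[OF elim(2)]) auto
      then have E_sets: "E \<in> sets (M N)"
        unfolding E_def by (intro sets.sets_Collect_finite_Ex sets.sets_Collect_conj borel_measurable_le) auto
      let ?C = "{\<omega> \<in> space (M N). \<Lambda> N \<omega> \<in> {- int B..int B}}"
      have C: "?C \<in> sets (M N)"
        using measurable_sets[OF meas[of N], of "{- int B..int B}"] by (simp add: vimage_def Int_def conj_commute)
      have "AE \<omega> in M N. \<omega> \<in> space (M N) \<longrightarrow> \<omega> \<in> A \<union> E \<union> ?C"
        using near_A
      proof (eventually_elim, intro impI)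
        fix \<omega>
        assume *: "\<omega> \<notin> A \<longrightarrow> \<Lambda> N \<omega> \<in> {lo N..hi N} \<and>
            (\<forall>i\<in>{- int 0..int 0}. ?X N \<omega> (\<Lambda> N \<omega>) \<le> ?X N \<omega> i + real_of_int (\<bar>\<Lambda> N \<omega>\<bar> + \<bar>i\<bar>) * \<zeta>)"
          and \<omega>: "\<omega> \<in> space (M N)"
        show "\<omega> \<in> A \<union> E \<union> ?C"
        proof (cases "\<omega> \<in> A \<or> \<Lambda> N \<omega> \<in> {- int B..int B}")
          case False
          have "?X N \<omega> (\<Lambda> N \<omega>) \<le> real_of_int \<bar>\<Lambda> N \<omega>\<bar> * \<zeta>"
            using * False by (auto simp: drift_walk_alt[of D _ 0])
          also have "\<dots> \<le> real_of_int \<bar>\<Lambda> N \<omega>\<bar> * (\<bar>D\<bar> / 8)"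
            by (intro mult_left_mono) (auto simp: \<zeta>_def)
          finally have "?X N \<omega> (\<Lambda> N \<omega>) \<le> real_of_int \<bar>\<Lambda> N \<omega>\<bar> * (\<bar>D\<bar> / 8)" .
          moreover have "\<Lambda> N \<omega> \<in> {lo N..hi N}" "int (Suc B) \<le> \<bar>\<Lambda> N \<omega>\<bar>"
            using * False by auto
          ultimately have "\<omega> \<in> E"
            using \<omega> unfolding E_def by blast
          then show ?thesis by simp
        qed (use \<omega> in auto)
      qed
      then have "N.prob (space (M N)) \<le> N.prob (A \<union> E \<union> ?C)"
        using A(1) E_sets C by (intro N.finite_measure_mono_AE) auto
      also have "\<dots> \<le> N.prob A + N.prob E + N.prob ?C"
        using measure_Un_le[of "A \<union> E" "M N" ?C] measure_Un_le[of A "M N" E] A(1) E_sets C by auto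
      also have "?C = (\<Union>l\<in>{- int B..int B}. {\<omega> \<in> space (M N). \<Lambda> N \<omega> = l})" by auto
      also have "N.prob \<dots> = (\<Sum>l\<in>{- int B..int B}. N.prob {\<omega> \<in> space (M N). \<Lambda> N \<omega> = l})"
        by (intro N.finite_measure_finite_Union) (auto simp: disjoint_family_on_def)
      finally show ?case
        using A(2) E by (simp add: \<zeta>_def N.prob_space)
    qed
    then show ?thesis by blast
  qed
qed

section \<open>Accuracy of the first stage\<close>

text \<open>The basic inequality of least squares, with \<open>h\<close> the fitted minus the true
  stump: expanding the squares bounds the energy of \<open>h\<close> by twice its inner product with
  the noise. Each of the three blocks returns half its energy plus 2 * \<open>\<kappa>\<close>^2;
  solving for the energy gives 12.\<close>

lemma three_piece_bound:
  fixes \<epsilon> h :: "nat \<Rightarrow> real" and c1 c2 c3 \<kappa> :: real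
  assumes G: "finite G" "G = A1 \<union> A2 \<union> A3" "A1 \<inter> A2 = {}" "A1 \<inter> A3 = {}" "A2 \<inter> A3 = {}"
    and h: "\<And>i. i \<in> A1 \<Longrightarrow> h i = c1" "\<And>i. i \<in> A2 \<Longrightarrow> h i = c2" "\<And>i. i \<in> A3 \<Longrightarrow> h i = c3"
    and noise: "\<And>A. A \<in> {A1, A2, A3} \<Longrightarrow> \<bar>\<Sum>i\<in>A. \<epsilon> i\<bar> \<le> \<kappa> * sqrt (card A)"
    and le: "(\<Sum>i\<in>G. (\<epsilon> i - h i)\<^sup>2) \<le> (\<Sum>i\<in>G. (\<epsilon> i)\<^sup>2)"
  shows "card A1 * c1\<^sup>2 + card A2 * c2\<^sup>2 + card A3 * c3\<^sup>2 \<le> 12 * \<kappa>\<^sup>2"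
proof -
  have split: "sum f G = sum f A1 + sum f A2 + sum f A3" for f :: "nat \<Rightarrow> real"
    using G by (simp add: sum.union_disjoint Int_Un_distrib2)
  \<comment> \<open>AM-GM with weights chosen so that half of the energy is absorbed on the left-hand side.\<close>
  have piece: "2 * c * (\<Sum>i\<in>A. \<epsilon> i) \<le> card A * c\<^sup>2 / 2 + 2 * \<kappa>\<^sup>2" if "A \<in> {A1, A2, A3}" for A and c :: real
  proof -
    have "2 * c * (\<Sum>i\<in>A. \<epsilon> i) \<le> 2 * \<bar>c\<bar> * \<bar>\<Sum>i\<in>A. \<epsilon> i\<bar>"
      using abs_ge_self[of "2 * c * (\<Sum>i\<in>A. \<epsilon> i)"] by (simp add: abs_mult)
    also have "\<dots> \<le> 2 * \<bar>c\<bar> * (\<kappa> * sqrt (card A))"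
      using noise[OF that] by (intro mult_left_mono) auto
    also have "\<dots> \<le> (sqrt (card A) * \<bar>c\<bar>)\<^sup>2 / 2 + 2 * \<kappa>\<^sup>2"
      using zero_le_power2[of "sqrt (card A) * \<bar>c\<bar> - 2 * \<kappa>"]
      by (simp add: power2_eq_square algebra_simps)
    finally show ?thesis by (simp add: power_mult_distrib)
  qed
  have "(\<Sum>i\<in>G. (h i)\<^sup>2) = (\<Sum>i\<in>G. (\<epsilon> i - h i)\<^sup>2) - (\<Sum>i\<in>G. (\<epsilon> i)\<^sup>2) + 2 * (\<Sum>i\<in>G. h i * \<epsilon> i)"
    by (simp add: sum_subtractf[symmetric] sum_distrib_left sum.distrib[symmetric] power2_eq_square algebra_simps)
  also have "\<dots> \<le> 2 * (\<Sum>i\<in>G. h i * \<epsilon> i)" using le by simp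
  also have "\<dots> = 2 * c1 * (\<Sum>i\<in>A1. \<epsilon> i) + 2 * c2 * (\<Sum>i\<in>A2. \<epsilon> i) + 2 * c3 * (\<Sum>i\<in>A3. \<epsilon> i)"
    unfolding split by (simp add: h sum_distrib_left[symmetric])
  also have "\<dots> \<le> (card A1 * c1\<^sup>2 + card A2 * c2\<^sup>2 + card A3 * c3\<^sup>2) / 2 + 6 * \<kappa>\<^sup>2"
    using piece[of A1 c1] piece[of A2 c2] piece[of A3 c3] by (simp add: add_divide_distrib)
  finally have "(\<Sum>i\<in>G. (h i)\<^sup>2) \<le> (card A1 * c1\<^sup>2 + card A2 * c2\<^sup>2 + card A3 * c3\<^sup>2) / 2 + 6 * \<kappa>\<^sup>2" .
  moreover have "(\<Sum>i\<in>G. (h i)\<^sup>2) = card A1 * c1\<^sup>2 + card A2 * c2\<^sup>2 + card A3 * c3\<^sup>2"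
    by (simp add: split h)
  moreover have "q \<le> 12 * \<kappa>\<^sup>2" if "q \<le> q / 2 + 6 * \<kappa>\<^sup>2" for q
    using that by simp
  ultimately show ?thesis by metis
qed

lemma abs_le_from_weighted_square:
  fixes x :: real
  assumes "n * x\<^sup>2 \<le> b" "b \<le> \<eta>\<^sup>2 * m" "m \<le> n" "0 < b" "0 < \<eta>"
  shows "\<bar>x\<bar> \<le> \<eta>"
proof -
  have "0 < \<eta>\<^sup>2 * m" using assms by linarith
  then have "0 < m" using \<open>0 < \<eta>\<close> by (simp add: zero_less_mult_iff)
  have "m * x\<^sup>2 \<le> n * x\<^sup>2" using assms by (intro mult_right_mono) auto
  also have "\<dots> \<le> m * \<eta>\<^sup>2" using assms by (simp add: mult.commute)
  finally have "x\<^sup>2 \<le> \<eta>\<^sup>2" using \<open>0 < m\<close> by simp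
  then show ?thesis using \<open>0 < \<eta>\<close> by (simp add: abs_le_square_iff[symmetric])
qed

text \<open>A fitted level \<open>x\<close> within half a jump of \<open>z\<close> is at least half
  a jump away from \<open>y\<close>, so each misclassified point costs a quarter of the squared
  jump; 48 is 4 * 12.\<close>

lemma weight_le_from_weighted_square:
  fixes x y :: real
  assumes "n * (x - y)\<^sup>2 \<le> 12 * \<kappa>\<^sup>2" "0 \<le> n" "\<bar>x - z\<bar> \<le> \<eta>" "\<eta> \<le> \<bar>z - y\<bar> / 2" "z \<noteq> y"
  shows "n \<le> 48 * \<kappa>\<^sup>2 / (z - y)\<^sup>2"
proof -
  have "\<bar>z - y\<bar> / 2 \<le> \<bar>x - y\<bar>"
    using assms(3,4) abs_triangle_ineq[of "z - x" "x - y"] by (simp add: abs_minus_commute)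
  then have "(\<bar>z - y\<bar> / 2)\<^sup>2 \<le> \<bar>x - y\<bar>\<^sup>2" by (intro power_mono) auto
  then have "(z - y)\<^sup>2 / 4 \<le> (x - y)\<^sup>2" by (simp add: power_divide)
  then have "n * ((z - y)\<^sup>2 / 4) \<le> n * (x - y)\<^sup>2" using \<open>0 \<le> n\<close> by (rule mult_left_mono)
  then show ?thesis using assms by (simp add: field_simps)
qed

text \<open>The order of deduction depends on the side of the error. If \<open>c \<le> r\<close>,
  the left block is all of the true left side, so \<open>a\<close> is accurate first. Then every
  point of the middle block, fitted by \<open>a\<close> instead of \<open>\<beta>\<close>, is
  costly, so the block is short. The right block therefore keeps at least \<open>g - K\<close>
  points, and \<open>b\<close> is accurate too. The other case is the mirror image.\<close>

lemma stump_fit_accuracy: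
  fixes \<epsilon> :: "nat \<Rightarrow> real" and \<kappa> g :: real
  assumes G: "finite G"
    and noise: "\<And>s t. \<bar>\<Sum>i | i \<in> G \<and> s < i \<and> i \<le> t. \<epsilon> i\<bar> \<le> \<kappa> * sqrt (card {i\<in>G. s < i \<and> i \<le> t})"
    and pos: "\<And>i. i \<in> G \<Longrightarrow> 0 < i"
    and le: "(\<Sum>i\<in>G. ((if i \<le> c then \<alpha> else \<beta>) + \<epsilon> i - (if i \<le> r then a else b))\<^sup>2) \<le> (\<Sum>i\<in>G. (\<epsilon> i)\<^sup>2)"
    and ne: "\<alpha> \<noteq> \<beta>" and "0 < \<kappa>" and \<eta>: "0 < \<eta>" "\<eta> \<le> \<bar>\<beta> - \<alpha>\<bar> / 2"
    and g: "g \<le> card {i\<in>G. i \<le> c}" "g \<le> card {i\<in>G. c < i}"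
      "12 * \<kappa>\<^sup>2 \<le> \<eta>\<^sup>2 * (g - 48 * \<kappa>\<^sup>2 / (\<beta> - \<alpha>)\<^sup>2)"
  shows "\<bar>a - \<alpha>\<bar> \<le> \<eta>" "\<bar>b - \<beta>\<bar> \<le> \<eta>"
    "card {i\<in>G. min r c < i \<and> i \<le> max r c} \<le> 48 * \<kappa>\<^sup>2 / (\<beta> - \<alpha>)\<^sup>2"
proof -
  define K where "K = 48 * \<kappa>\<^sup>2 / (\<beta> - \<alpha>)\<^sup>2"
  define d where "d = (if c \<le> r then a - \<beta> else b - \<alpha>)"
  define A1 where "A1 = {i\<in>G. i \<le> min r c}"
  define A2 where "A2 = {i\<in>G. min r c < i \<and> i \<le> max r c}"
  define A3 where "A3 = {i\<in>G. max r c < i}"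
  \<comment> \<open>The noise hypothesis speaks of intervals open on the left with a finite right
    end; \<open>t\<close> and positivity of the indices put the outer blocks in this form.\<close>
  obtain t where t: "\<And>i. i \<in> G \<Longrightarrow> i \<le> t" using G finite_nat_set_iff_bounded_le by auto
  have A: "A1 = {i\<in>G. 0 < i \<and> i \<le> min r c}" "A3 = {i\<in>G. max r c < i \<and> i \<le> t}"
    using pos t by (auto simp: A1_def A3_def)
  have fin: "finite A1" "finite A2" "finite A3" using G by (auto simp: A1_def A2_def A3_def)
  have bound: "card A1 * (a - \<alpha>)\<^sup>2 + card A2 * d\<^sup>2 + card A3 * (b - \<beta>)\<^sup>2 \<le> 12 * \<kappa>\<^sup>2"
  proof (rule three_piece_bound[where G = G and \<epsilon> = \<epsilon> and h = "\<lambda>i. (if i \<le> r then a else b) - (if i \<le> c then \<alpha> else \<beta>)"])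
    show "(\<Sum>i\<in>G. (\<epsilon> i - ((if i \<le> r then a else b) - (if i \<le> c then \<alpha> else \<beta>)))\<^sup>2) \<le> (\<Sum>i\<in>G. (\<epsilon> i)\<^sup>2)"
      using le by (simp add: algebra_simps)
    show "\<bar>sum \<epsilon> A\<bar> \<le> \<kappa> * sqrt (real (card A))" if "A \<in> {A1, A2, A3}" for A
      using that noise[of 0 "min r c"] noise[of "min r c" "max r c"] noise[of "max r c" t]
      unfolding A(1) A(2) A2_def by blast
  qed (use G in \<open>auto simp: A1_def A2_def A3_def d_def\<close>)
  have nn: "0 \<le> real n * x\<^sup>2" for n :: nat and x :: real by simp
  have bounds: "card A1 * (a - \<alpha>)\<^sup>2 \<le> 12 * \<kappa>\<^sup>2"
      "card A2 * d\<^sup>2 \<le> 12 * \<kappa>\<^sup>2" "card A3 * (b - \<beta>)\<^sup>2 \<le> 12 * \<kappa>\<^sup>2"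
    using bound nn[of "card A1" "a - \<alpha>"] nn[of "card A2" d] nn[of "card A3" "b - \<beta>"] by linarith+
  have K: "0 \<le> K" by (simp add: K_def)
  have g': "12 * \<kappa>\<^sup>2 \<le> \<eta>\<^sup>2 * (g - K)" "g - K \<le> g" "0 < 12 * \<kappa>\<^sup>2" using g K \<open>0 < \<kappa>\<close> by (auto simp: K_def)
  have "\<bar>a - \<alpha>\<bar> \<le> \<eta> \<and> \<bar>b - \<beta>\<bar> \<le> \<eta> \<and> card A2 \<le> K"
  proof (cases "c \<le> r")
    case True
    have "{i\<in>G. c < i} = A2 \<union> A3" "A1 = {i\<in>G. i \<le> c}" using True by (auto simp: A1_def A2_def A3_def)
    moreover have "A2 \<inter> A3 = {}" by (auto simp: A2_def A3_def)
    ultimately have cards: "g \<le> card A1" "g \<le> real (card A2) + card A3"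
      using g fin by (auto simp: card_Un_disjoint)
    have a: "\<bar>a - \<alpha>\<bar> \<le> \<eta>"
      by (rule abs_le_from_weighted_square[OF bounds(1) g'(1)]) (use cards g' \<eta> in auto)
    have "card A2 \<le> 48 * \<kappa>\<^sup>2 / (\<alpha> - \<beta>)\<^sup>2"
      by (rule weight_le_from_weighted_square[OF _ _ a]) (use bounds(2) True d_def \<eta> ne in \<open>auto simp: abs_minus_commute\<close>)
    then have A2: "card A2 \<le> K" by (simp add: K_def power2_commute)
    have "\<bar>b - \<beta>\<bar> \<le> \<eta>"
      by (rule abs_le_from_weighted_square[OF bounds(3) g'(1)]) (use cards g' \<eta> A2 in auto)
    with a A2 show ?thesis by simp
  next
    case False
    have "{i\<in>G. i \<le> c} = A1 \<union> A2" "A3 = {i\<in>G. c < i}" using False by (auto simp: A1_def A2_def A3_def)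
    moreover have "A1 \<inter> A2 = {}" by (auto simp: A1_def A2_def)
    ultimately have cards: "g \<le> card A3" "g \<le> real (card A1) + card A2"
      using g fin by (auto simp: card_Un_disjoint)
    have b: "\<bar>b - \<beta>\<bar> \<le> \<eta>"
      by (rule abs_le_from_weighted_square[OF bounds(3) g'(1)]) (use cards g' \<eta> in auto)
    have A2: "card A2 \<le> K"
      unfolding K_def
      by (rule weight_le_from_weighted_square[OF _ _ b]) (use bounds(2) False d_def \<eta> ne in auto)
    have "\<bar>a - \<alpha>\<bar> \<le> \<eta>"
      by (rule abs_le_from_weighted_square[OF bounds(1) g'(1)]) (use cards g' \<eta> A2 in auto)
    with b A2 show ?thesis by simp
  qed
  then show "\<bar>a - \<alpha>\<bar> \<le> \<eta>" "\<bar>b - \<beta>\<bar> \<le> \<eta>"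
    "card {i\<in>G. min r c < i \<and> i \<le> max r c} \<le> 48 * \<kappa>\<^sup>2 / (\<beta> - \<alpha>)\<^sup>2"
    by (auto simp: A2_def K_def)
qed

section \<open>The second-stage loss as a walk in the rank\<close>

text \<open>The signed number of points of \<open>U\<close> between \<open>c\<close> and \<open>i\<close>. On \<open>U\<close> it vanishes at the largest
  element not exceeding \<open>c\<close>, so that ranks \<open>\<le> 0\<close> belong to the left regime.\<close>

definition rank_from :: "nat set \<Rightarrow> nat \<Rightarrow> nat \<Rightarrow> int" where
  "rank_from U c i = int (card {j\<in>U. c < j \<and> j \<le> i}) - int (card {j\<in>U. i < j \<and> j \<le> c})"

lemma card_interval_split:
  assumes "finite U" "i \<le> j" "j \<le> (k :: nat)"
  shows "card {x\<in>U. i < x \<and> x \<le> k} = card {x\<in>U. i < x \<and> x \<le> j} + card {x\<in>U. j < x \<and> x \<le> k}"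
proof -
  have "{x\<in>U. i < x \<and> x \<le> k} = {x\<in>U. i < x \<and> x \<le> j} \<union> {x\<in>U. j < x \<and> x \<le> k}"
    using assms by auto
  then show ?thesis using assms(1) by (simp add: card_Un_disjoint disjoint_iff)
qed

text \<open>The base point only fixes the additive constant: increments count points of
  \<open>U\<close> wherever \<open>c\<close> lies. The cases are the positions of \<open>c\<close>
  relative to \<open>i\<close> and \<open>j\<close>.\<close>

lemma rank_from_diff:
  assumes "finite U" "i \<le> j"
  shows "rank_from U c j - rank_from U c i = int (card {x\<in>U. i < x \<and> x \<le> j})"
proof -
  have empty: "{x\<in>U. a < x \<and> x \<le> b} = {}" if "b \<le> a" for a b using that by auto
  consider "c \<le> i" | "i \<le> c" "c \<le> j" | "j \<le> c" by linarith
  then show ?thesis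
    using assms by cases (auto simp: rank_from_def empty card_interval_split[of U c i j]
        card_interval_split[of U i c j] card_interval_split[of U i j c])
qed

lemma rank_from_less_iff:
  assumes "finite U" "i \<in> U" "j \<in> U"
  shows "rank_from U c i < rank_from U c j \<longleftrightarrow> i < j"
proof -
  have less: "rank_from U c i < rank_from U c j" if "i < j" "j \<in> U" for i j
  proof -
    have "j \<in> {x\<in>U. i < x \<and> x \<le> j}" using that by simp
    then have "0 < card {x\<in>U. i < x \<and> x \<le> j}" using assms(1) by (auto simp: card_gt_0_iff)
    then show ?thesis using rank_from_diff[OF assms(1), of i j c] that by simp
  qed
  show ?thesis
    using less[of i j] less[of j i] assms by (cases i j rule: linorder_cases) auto
qed

lemma rank_from_le_iff:
  assumes "finite U" "i \<in> U" "j \<in> U"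
  shows "rank_from U c i \<le> rank_from U c j \<longleftrightarrow> i \<le> j"
  using rank_from_less_iff[OF assms(1,3,2), of c] by (simp add: not_less[symmetric])

lemma rank_from_pos_iff:
  assumes "finite U" "i \<in> U"
  shows "0 < rank_from U c i \<longleftrightarrow> c < i"
proof
  assume "c < i"
  then have "i \<in> {j\<in>U. c < j \<and> j \<le> i}" "{j\<in>U. i < j \<and> j \<le> c} = {}" using assms by auto
  then have "0 < card {j\<in>U. c < j \<and> j \<le> i}" using assms(1) by (auto simp: card_gt_0_iff)
  then show "0 < rank_from U c i"
    unfolding rank_from_def \<open>{j\<in>U. i < j \<and> j \<le> c} = {}\<close> by simp
next
  assume "0 < rank_from U c i"
  then have "0 < card {j\<in>U. c < j \<and> j \<le> i}" unfolding rank_from_def by linarith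
  then have "{j\<in>U. c < j \<and> j \<le> i} \<noteq> {}" unfolding card_gt_0_iff by blast
  then show "c < i" by auto
qed

text \<open>Strict monotonicity gives injectivity, and the values lie in an integer interval with
  exactly \<open>card U\<close> elements, so counting gives surjectivity.\<close>

lemma rank_from_bij:
  assumes U: "finite U"
  shows "bij_betw (rank_from U c) U {1 - int (card {j\<in>U. j \<le> c})..int (card {j\<in>U. c < j})}"
proof -
  let ?R = "{1 - int (card {j\<in>U. j \<le> c})..int (card {j\<in>U. c < j})}"
  have inj: "inj_on (rank_from U c) U"
    by (rule inj_onI) (metis U rank_from_less_iff less_irrefl linorder_neqE_nat)
  have sub: "rank_from U c ` U \<subseteq> ?R"
  proof
    fix m assume "m \<in> rank_from U c ` U"
    then obtain i where i: "i \<in> U" "m = rank_from U c i" by auto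
    have "card {j\<in>U. c < j \<and> j \<le> i} \<le> card {j\<in>U. c < j}"
      using U by (intro card_mono) auto
    moreover have "card {j\<in>U. i < j \<and> j \<le> c} < card {j\<in>U. j \<le> c}" if "i \<le> c"
      using U that i by (intro psubset_card_mono) auto
    moreover have "{j\<in>U. i < j \<and> j \<le> c} = {}" if "c < i" using that by auto
    ultimately show "m \<in> ?R"
      using rank_from_pos_iff[OF U i(1), of c] by (cases "c < i") (auto simp: i(2) rank_from_def)
  qed
  have "U = {j\<in>U. j \<le> c} \<union> {j\<in>U. c < j}" by auto
  then have "card U = card {j\<in>U. j \<le> c} + card {j\<in>U. c < j}"
    using U card_Un_disjoint[of "{j\<in>U. j \<le> c}" "{j\<in>U. c < j}"] by (simp add: disjoint_iff)
  then have "card (rank_from U c ` U) = card ?R"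
    using card_image[OF inj] by simp
  then have "rank_from U c ` U = ?R"
    using sub by (intro card_subset_eq) auto
  with inj show ?thesis by (simp add: bij_betw_def)
qed

text \<open>If enough points of \<open>U\<close> lie within distance \<open>h\<close> of
  \<open>c\<close>, all small ranks are used up there. The left side must supply one point more
  because rank zero lies on it.\<close>

lemma rank_from_small:
  assumes U: "finite U" "x \<in> U" and x: "\<bar>rank_from U c x\<bar> \<le> int b"
    and dense: "b \<le> card {j\<in>U. c < j \<and> j \<le> c + h}" "b < card {j\<in>U. c - h < j \<and> j \<le> c}"
  shows "c - h < x" "x \<le> c + h"
proof -
  show "x \<le> c + h"
  proof (rule ccontr)
    assume "\<not> x \<le> c + h"
    then have "x \<in> {j\<in>U. c + h < j \<and> j \<le> x}" "finite {j\<in>U. c + h < j \<and> j \<le> x}"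
      using U by auto
    then have "0 < card {j\<in>U. c + h < j \<and> j \<le> x}"
      unfolding card_gt_0_iff by blast
    then have "rank_from U c x > rank_from U c (c + h)"
      using rank_from_diff[OF U(1), of "c + h" x c] \<open>\<not> x \<le> c + h\<close> by simp
    moreover have empty: "{j\<in>U. c + h < j \<and> j \<le> c} = {}" by auto
    have "int b \<le> rank_from U c (c + h)"
      unfolding rank_from_def empty using dense(1) by simp
    ultimately show False using x by linarith
  qed
  show "c - h < x"
  proof (rule ccontr)
    assume "\<not> c - h < x"
    then have "rank_from U c x \<le> rank_from U c (c - h)"
      using rank_from_diff[OF U(1), of x "c - h" c] by simp
    moreover have empty: "{j\<in>U. c < j \<and> j \<le> c - h} = {}" by auto
    have "rank_from U c (c - h) < - int b"
      unfolding rank_from_def empty using dense(2) by simp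
    ultimately show False using x by linarith
  qed
qed

text \<open>Switching the split point from the rank-zero index to the index \<open>d\<close> changes the loss only at
  the ranks strictly between, which turns the loss difference into a walk in the rank.\<close>

lemma loss_difference_walk:
  fixes y \<epsilon> :: "nat \<Rightarrow> real"
  assumes U: "finite U" and \<pi>: "\<pi> = inv_into U (rank_from U c)"
    and W: "W \<subseteq> U" "z \<in> W" "d \<in> W" "\<And>j. j \<in> U \<Longrightarrow> min z d \<le> j \<Longrightarrow> j \<le> max z d \<Longrightarrow> j \<in> W"
    and z: "rank_from U c z = 0"
    and y: "\<And>i. i \<in> U \<Longrightarrow> y i = (if i \<le> c then \<alpha> else \<beta>) + \<epsilon> i"
  defines "n \<equiv> rank_from U c d"
  shows "(\<Sum>i\<in>W. (y i - (if i \<le> d then a else b))\<^sup>2) - (\<Sum>i\<in>W. (y i - (if i \<le> z then a else b))\<^sup>2)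
    = (b - a) * (2 * ((\<Sum>m\<in>{1..n}. \<epsilon> (\<pi> m)) - (\<Sum>m\<in>{n+1..0}. \<epsilon> (\<pi> m)))
        + (if 0 \<le> n then n * (2 * \<beta> - a - b) else n * (2 * \<alpha> - a - b)))"
proof -
  \<comment> \<open>The price of moving index \<open>i\<close> from level \<open>b\<close> to level
    \<open>a\<close>: (y - a)^2 - (y - b)^2 factors in this way.\<close>
  define q where "q i = (b - a) * (2 * y i - a - b)" for i
  have finW: "finite W" using U W finite_subset by auto
  let ?r = "rank_from U c"
  have \<pi>_r: "\<pi> (?r i) = i" if "i \<in> U" for i
    using that rank_from_bij[OF U, of c] by (simp add: \<pi> bij_betw_def)
  have r_\<pi>: "?r (\<pi> m) = m" "\<pi> m \<in> U" if "m \<in> ?r ` U" for m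
    using that by (auto simp: \<pi> f_inv_into_f inv_into_into)
  \<comment> \<open>The attained ranks form an integer interval, so every integer between two of
    them is the rank of some index.\<close>
  have conv: "m \<in> ?r ` U" if "i \<in> U" "j \<in> U" "?r i \<le> m" "m \<le> ?r j" for i j m
  proof -
    have img: "?r ` U = {1 - int (card {j\<in>U. j \<le> c})..int (card {j\<in>U. c < j})}"
      using rank_from_bij[OF U, of c] by (simp add: bij_betw_def)
    have "?r i \<in> ?r ` U" "?r j \<in> ?r ` U" using that by auto
    then show ?thesis using that(3,4) unfolding img by simp
  qed
  have "(\<Sum>i\<in>W. (y i - (if i \<le> d then a else b))\<^sup>2) - (\<Sum>i\<in>W. (y i - (if i \<le> z then a else b))\<^sup>2)
     = (\<Sum>i\<in>W. (if z < i \<and> i \<le> d then q i else 0) - (if d < i \<and> i \<le> z then q i else 0))"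
    unfolding sum_subtractf[symmetric]
    by (intro sum.cong) (auto simp: q_def power2_eq_square algebra_simps)
  also have "\<dots> = (\<Sum>i\<in>{i\<in>W. z < i \<and> i \<le> d}. q i) - (\<Sum>i\<in>{i\<in>W. d < i \<and> i \<le> z}. q i)"
    using finW by (simp add: sum_subtractf sum.If_cases Int_def)
  also have "(\<Sum>i\<in>{i\<in>W. z < i \<and> i \<le> d}. q i) = (\<Sum>m\<in>{1..n}. q (\<pi> m))"
  proof (rule sum.reindex_bij_witness[of _ \<pi> ?r])
    fix i assume "i \<in> {i\<in>W. z < i \<and> i \<le> d}"
    then have i: "i \<in> U" "i \<in> W" "z < i" "i \<le> d" using W by auto
    show "\<pi> (?r i) = i" using \<pi>_r[OF i(1)] .
    then show "q (\<pi> (?r i)) = q i" by simp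
    show "?r i \<in> {1..n}"
      using i W rank_from_less_iff[OF U, of z i c] rank_from_le_iff[OF U, of i d c] z
      by (auto simp: n_def)
  next
    fix m assume m: "m \<in> {1..n}"
    then have mU: "m \<in> ?r ` U" using conv[of z d m] W z by (auto simp: n_def)
    then show "?r (\<pi> m) = m" using r_\<pi> by simp
    have "z < \<pi> m" "\<pi> m \<le> d"
      using m W r_\<pi>[OF mU] rank_from_less_iff[OF U, of z "\<pi> m" c] rank_from_le_iff[OF U, of "\<pi> m" d c] z
      by (auto simp: n_def)
    then show "\<pi> m \<in> {i\<in>W. z < i \<and> i \<le> d}" using W(4)[of "\<pi> m"] r_\<pi>[OF mU] by auto
  qed
  also have "(\<Sum>i\<in>{i\<in>W. d < i \<and> i \<le> z}. q i) = (\<Sum>m\<in>{n+1..0}. q (\<pi> m))"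
  proof (rule sum.reindex_bij_witness[of _ \<pi> ?r])
    fix i assume "i \<in> {i\<in>W. d < i \<and> i \<le> z}"
    then have i: "i \<in> U" "i \<in> W" "d < i" "i \<le> z" using W by auto
    show "\<pi> (?r i) = i" using \<pi>_r[OF i(1)] .
    then show "q (\<pi> (?r i)) = q i" by simp
    show "?r i \<in> {n+1..0}"
      using i W rank_from_less_iff[OF U, of d i c] rank_from_le_iff[OF U, of i z c] z
      by (auto simp: n_def)
  next
    fix m assume m: "m \<in> {n+1..0}"
    then have mU: "m \<in> ?r ` U" using conv[of d z m] W z by (auto simp: n_def)
    then show "?r (\<pi> m) = m" using r_\<pi> by simp
    have "d < \<pi> m" "\<pi> m \<le> z"
      using m W r_\<pi>[OF mU] rank_from_less_iff[OF U, of d "\<pi> m" c] rank_from_le_iff[OF U, of "\<pi> m" z c] z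
      by (auto simp: n_def)
    then show "\<pi> m \<in> {i\<in>W. d < i \<and> i \<le> z}" using W(4)[of "\<pi> m"] r_\<pi>[OF mU] by auto
  qed
  also have "(\<Sum>m\<in>{1..n}. q (\<pi> m)) = (\<Sum>m\<in>{1..n}. (b - a) * (2 * \<epsilon> (\<pi> m) + (2 * \<beta> - a - b)))"
  proof (rule sum.cong)
    fix m assume m: "m \<in> {1..n}"
    then have mU: "m \<in> ?r ` U" using conv[of z d m] W z by (auto simp: n_def)
    then have "c < \<pi> m" using rank_from_pos_iff[OF U r_\<pi>(2)[OF mU], of c] r_\<pi>(1)[OF mU] m by auto
    then show "q (\<pi> m) = (b - a) * (2 * \<epsilon> (\<pi> m) + (2 * \<beta> - a - b))"
      using y[OF r_\<pi>(2)[OF mU]] by (simp add: q_def)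
  qed simp
  also have "(\<Sum>m\<in>{n+1..0}. q (\<pi> m)) = (\<Sum>m\<in>{n+1..0}. (b - a) * (2 * \<epsilon> (\<pi> m) + (2 * \<alpha> - a - b)))"
  proof (rule sum.cong)
    fix m assume m: "m \<in> {n+1..0}"
    then have mU: "m \<in> ?r ` U" using conv[of d z m] W z by (auto simp: n_def)
    then have "\<pi> m \<le> c" using rank_from_pos_iff[OF U r_\<pi>(2)[OF mU], of c] r_\<pi>(1)[OF mU] m by auto
    then show "q (\<pi> m) = (b - a) * (2 * \<epsilon> (\<pi> m) + (2 * \<alpha> - a - b))"
      using y[OF r_\<pi>(2)[OF mU]] by (simp add: q_def)
  qed simp
  finally show ?thesis
    by (cases "0 \<le> n")
      (simp_all add: sum_distrib_left[symmetric] sum.distrib right_diff_distrib distrib_left mult.left_commute[of _ 2])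
qed

text \<open>Levels accurate to less than half the jump preserve its sign, so after division by
  \<open>2 * \<sigma> * \<bar>b - a\<bar>\<close> the noise part agrees exactly with that of the
  drift walk. Only the drift is off, by at most \<open>\<eta> / \<sigma>\<close> per unit of
  rank.\<close>

lemma loss_difference_close:
  fixes y \<epsilon> :: "nat \<Rightarrow> real"
  assumes U: "finite U" and \<pi>: "\<pi> = inv_into U (rank_from U c)"
    and W: "W \<subseteq> U" "z \<in> W" "d \<in> W" "\<And>j. j \<in> U \<Longrightarrow> min z d \<le> j \<Longrightarrow> j \<le> max z d \<Longrightarrow> j \<in> W"
    and z: "rank_from U c z = 0"
    and y: "\<And>i. i \<in> U \<Longrightarrow> y i = (if i \<le> c then \<alpha> else \<beta>) + \<epsilon> i"
    and ab: "\<bar>a - \<alpha>\<bar> \<le> \<eta>" "\<bar>b - \<beta>\<bar> \<le> \<eta>" "\<eta> < \<bar>\<beta> - \<alpha>\<bar> / 2" and "0 < \<sigma>"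
  shows "\<bar>((\<Sum>i\<in>W. (y i - (if i \<le> d then a else b))\<^sup>2) - (\<Sum>i\<in>W. (y i - (if i \<le> z then a else b))\<^sup>2))
        / (2 * \<sigma> * \<bar>b - a\<bar>)
      - drift_walk ((\<beta> - \<alpha>) / \<sigma>) (\<lambda>m. \<epsilon> (\<pi> m) / \<sigma>) (rank_from U c d)\<bar>
    \<le> \<bar>rank_from U c d\<bar> * (\<eta> / \<sigma>)"
proof -
  define n where "n = rank_from U c d"
  define S where "S = (\<Sum>m\<in>{1..n}. \<epsilon> (\<pi> m)) - (\<Sum>m\<in>{n+1..0}. \<epsilon> (\<pi> m))"
  define s where "s = sgn (\<beta> - \<alpha>)"
  have s: "sgn (b - a) = s" "b \<noteq> a" "\<bar>\<beta> - \<alpha>\<bar> = s * (\<beta> - \<alpha>)" "\<bar>s\<bar> = 1" "\<bar>b - a\<bar> = s * (b - a)" "s * s = 1"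
    using ab unfolding s_def by (auto simp: sgn_real_def abs_if split: if_splits)
  have "sgn ((\<beta> - \<alpha>) / \<sigma>) = s" "\<bar>(\<beta> - \<alpha>) / \<sigma>\<bar> = s * (\<beta> - \<alpha>) / \<sigma>"
    using \<open>0 < \<sigma>\<close> by (simp_all only: s_def sgn_divide abs_divide s(3)[unfolded s_def]) simp_all
  then have X: "drift_walk ((\<beta> - \<alpha>) / \<sigma>) (\<lambda>m. \<epsilon> (\<pi> m) / \<sigma>) n = s * S / \<sigma> + \<bar>n\<bar> * (s * (\<beta> - \<alpha>)) / (2 * \<sigma>)"
    by (simp only: drift_walk_alt S_def sum_divide_distrib[symmetric] diff_divide_distrib[symmetric]) simp
  define D where "D = (if 0 \<le> n then n * (2 * \<beta> - a - b) else n * (2 * \<alpha> - a - b))"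
  have L: "(b - a) * (2 * S + D) / (2 * \<sigma> * \<bar>b - a\<bar>) = s * S / \<sigma> + s * D / (2 * \<sigma>)"
  proof -
    have "(b - a) = s * \<bar>b - a\<bar>" using s by (simp add: mult.assoc[symmetric])
    then have "(b - a) * (2 * S + D) / (2 * \<sigma> * \<bar>b - a\<bar>) = (s * (2 * S + D)) * \<bar>b - a\<bar> / ((2 * \<sigma>) * \<bar>b - a\<bar>)"
      by (metis mult.assoc mult.commute)
    also have "\<dots> = s * (2 * S + D) / (2 * \<sigma>)" using s(2) by (intro nonzero_mult_divide_mult_cancel_right) simp
    finally show ?thesis using \<open>0 < \<sigma>\<close> by (simp add: field_simps)
  qed
  \<comment> \<open>The drift bias has the same slope for ranks of either sign.\<close>
  have "D - \<bar>n\<bar> * (\<beta> - \<alpha>) = n * (\<alpha> - a + (\<beta> - b))"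
    by (simp add: D_def algebra_simps)
  then have "s * D / (2 * \<sigma>) - \<bar>n\<bar> * (s * (\<beta> - \<alpha>)) / (2 * \<sigma>) = s * (n * (\<alpha> - a + (\<beta> - b))) / (2 * \<sigma>)"
    by (simp add: diff_divide_distrib[symmetric] right_diff_distrib[symmetric] mult.left_commute[of _ s])
  then have "\<bar>s * D / (2 * \<sigma>) - \<bar>n\<bar> * (s * (\<beta> - \<alpha>)) / (2 * \<sigma>)\<bar> = \<bar>n\<bar> * (\<bar>\<alpha> - a + (\<beta> - b)\<bar> / (2 * \<sigma>))"
    using s(4) \<open>0 < \<sigma>\<close> by (simp add: abs_mult abs_divide)
  also have "\<dots> \<le> \<bar>n\<bar> * (2 * \<eta> / (2 * \<sigma>))"
    using ab \<open>0 < \<sigma>\<close> by (intro mult_left_mono divide_right_mono) auto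
  finally have "\<bar>s * D / (2 * \<sigma>) - \<bar>n\<bar> * (s * (\<beta> - \<alpha>)) / (2 * \<sigma>)\<bar> \<le> \<bar>n\<bar> * (\<eta> / \<sigma>)" by simp
  moreover have "(\<Sum>i\<in>W. (y i - (if i \<le> d then a else b))\<^sup>2) - (\<Sum>i\<in>W. (y i - (if i \<le> z then a else b))\<^sup>2)
      = (b - a) * (2 * S + D)"
    unfolding n_def S_def D_def by (rule loss_difference_walk[OF U \<pi> W z y])
  ultimately show ?thesis
    unfolding n_def[symmetric] by (simp only: L X add_diff_add)
qed

section \<open>The two grids\<close>

lemma stage1_grid_iff:
  assumes "0 < N"
  shows "real i / real N \<in> stage1_grid \<gamma> K1 N \<longleftrightarrow>
    0 < i \<and> i < N \<and> nat \<lfloor>real N / (K1 * real N powr \<gamma>)\<rfloor> dvd i"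
proof -
  have "real i / real N = real j / real N \<longleftrightarrow> i = j" for j using assms by simp
  then show ?thesis by (auto simp: stage1_grid_def)
qed

lemma stump_at_index:
  assumes "0 < N"
  shows "stump a b (real r / real N) (real i / real N) = (if i \<le> r then a else b)"
  using assms by (simp add: stump_def divide_le_cancel divide_less_cancel)

lemma stump_floor:
  assumes "0 < N" "0 < t"
  shows "stump a b t (real i / real N) = (if i \<le> nat \<lfloor>real N * t\<rfloor> then a else b)"
proof -
  have "i \<le> nat \<lfloor>real N * t\<rfloor> \<longleftrightarrow> real i / real N \<le> t"
    using assms by (simp add: le_nat_iff le_floor_iff field_simps)
  then show ?thesis by (auto simp: stump_def)
qed

lemma signed_count_eq_rank:
  assumes "0 < N"
  shows "signed_count \<gamma> K1 N (real c / real N) (real i / real N) =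
    rank_from {j\<in>{1..N}. real j / real N \<notin> stage1_grid \<gamma> K1 N} c i"
proof -
  let ?U = "{j\<in>{1..N}. real j / real N \<notin> stage1_grid \<gamma> K1 N}"
  have sum: "(\<Sum>j=1..N. of_bool (real a / real N < real j / real N \<and> real j / real N \<le> real b / real N \<and>
      real j / real N \<notin> stage1_grid \<gamma> K1 N)) = int (card {j\<in>?U. a < j \<and> j \<le> b})" for a b
  proof -
    have "(real a / real N < real j / real N \<and> real j / real N \<le> real b / real N) \<longleftrightarrow> (a < j \<and> j \<le> b)" for j
      using assms by (simp add: divide_le_cancel divide_less_cancel)
    then have "(\<Sum>j=1..N. of_bool (real a / real N < real j / real N \<and> real j / real N \<le> real b / real N \<and>
      real j / real N \<notin> stage1_grid \<gamma> K1 N)) = (\<Sum>j=1..N. of_bool (j \<in> {j\<in>?U. a < j \<and> j \<le> b}) :: int)"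
      by (intro sum.cong arg_cong[where f = of_bool]) auto
    also have "\<dots> = int (card ({1..N} \<inter> {j\<in>?U. a < j \<and> j \<le> b}))"
      by (subst sum_of_bool_eq) (auto intro!: arg_cong[where f = card])
    also have "{1..N} \<inter> {j\<in>?U. a < j \<and> j \<le> b} = {j\<in>?U. a < j \<and> j \<le> b}" by auto
    finally show ?thesis .
  qed
  show ?thesis
  proof (cases "c \<le> i")
    case True
    then have empty: "{j\<in>?U. i < j \<and> j \<le> c} = {}" and "real c / real N \<le> real i / real N"
      using assms by (auto simp: divide_le_cancel)
    then show ?thesis unfolding signed_count_def sum rank_from_def empty by simp
  next
    case False
    then have empty: "{j\<in>?U. c < j \<and> j \<le> i} = {}" and "\<not> real c / real N \<le> real i / real N"
      using assms by (auto simp: divide_le_cancel)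
    then show ?thesis unfolding signed_count_def sum rank_from_def empty by simp
  qed
qed

lemma card_multiples_ge:
  assumes "0 < k" "s \<le> t"
  shows "(real t - real s) / real k - 1 \<le> card {i. s < i \<and> i \<le> t \<and> k dvd i}"
proof -
  have "(\<lambda>j. j * k) ` {s div k<..t div k} \<subseteq> {i. s < i \<and> i \<le> t \<and> k dvd i}"
    using assms by (auto simp: div_less_iff_less_mult less_eq_div_iff_mult_less_eq)
  then have "card ((\<lambda>j. j * k) ` {s div k<..t div k}) \<le> card {i. s < i \<and> i \<le> t \<and> k dvd i}"
    by (intro card_mono) auto
  then have "t div k - s div k \<le> card {i. s < i \<and> i \<le> t \<and> k dvd i}"
    using assms by (simp add: card_image inj_on_def)
  moreover have "real t / real k < real (t div k) + 1"
    using assms by (simp add: divide_less_eq) (metis dividend_less_div_times mult.commute add.commute of_nat_less_iff of_nat_add of_nat_mult of_nat_1 distrib_left mult_1_right)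
  moreover have "real (s div k) \<le> real s / real k"
    using assms div_times_less_eq_dividend[of s k] by (simp add: le_divide_eq flip: of_nat_mult)
  ultimately show ?thesis by (simp add: diff_divide_distrib)
qed

text \<open>Two distinct multiples of \<open>k\<close> differ by at least \<open>k\<close>, so a
  stretch of at most \<open>k\<close> consecutive integers loses at most one of them to the coarse
  grid.\<close>

lemma card_nonmultiples_ge:
  fixes h k s :: nat
  assumes "h \<le> k"
  shows "h - 1 \<le> card {i. s < i \<and> i \<le> s + h \<and> \<not> k dvd i}"
proof -
  let ?A = "{i. s < i \<and> i \<le> s + h \<and> k dvd i}"
  have fin: "finite ?A" by (rule finite_subset[of _ "{..s + h}"]) auto
  have "i = j" if "i \<in> ?A" "j \<in> ?A" for i j
  proof (rule ccontr)
    assume "i \<noteq> j"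
    then have "k \<le> max i j - min i j"
      using that by (intro dvd_imp_le dvd_diff_nat) (auto simp: max_def min_def)
    then show False using that assms by (auto simp: max_def min_def split: if_splits)
  qed
  then have "card ?A \<le> 1" using fin by (simp add: card_le_Suc0_iff_eq)
  have eq: "{i. s < i \<and> i \<le> s + h \<and> \<not> k dvd i} = {s<..s+h} - ?A" by auto
  have "card {s<..s+h} - card ?A \<le> card ({s<..s+h} - ?A)"
    by (rule diff_card_le_card_Diff[OF fin])
  with \<open>card ?A \<le> 1\<close> show ?thesis unfolding eq by simp
qed

text \<open>Optimality is used against one competitor only: the true levels, split at a grid point.
  The true change point need not lie on the grid; \<open>k \<le> c\<close> provides a positive
  multiple of \<open>k\<close> not exceeding \<open>c\<close>.\<close>

lemma stage1_minimizer_fit: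
  assumes min: "stage1_minimizer \<gamma> K1 N y a1 b1 t1" and N: "0 < N" and \<tau>: "0 < \<tau>" "\<tau> < 1"
    and y: "\<And>i. i \<in> {1..N} \<Longrightarrow> y i = stump \<alpha> \<beta> \<tau> (real i / real N) + \<epsilon> i"
  defines "k \<equiv> nat \<lfloor>real N / (K1 * real N powr \<gamma>)\<rfloor>" and "c \<equiv> nat \<lfloor>real N * \<tau>\<rfloor>"
  defines "G \<equiv> {i. 0 < i \<and> i < N \<and> k dvd i}"
  assumes k: "0 < k" "k \<le> c"
  obtains r where "r \<in> G" "t1 = real r / real N"
    "(\<Sum>i\<in>G. ((if i \<le> c then \<alpha> else \<beta>) + \<epsilon> i - (if i \<le> r then a1 else b1))\<^sup>2) \<le> (\<Sum>i\<in>G. (\<epsilon> i)\<^sup>2)"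
proof -
  have grid: "real i / real N \<in> stage1_grid \<gamma> K1 N \<longleftrightarrow> i \<in> G" for i
    using stage1_grid_iff[OF N] by (simp add: G_def k_def)
  have "c < N"
  proof -
    have "real N * \<tau> < real N" using N \<tau> by simp
    then have "\<lfloor>real N * \<tau>\<rfloor> < int N" by (simp add: floor_less_iff)
    then show ?thesis using N by (simp add: c_def)
  qed
  have loss: "stump_loss N (stage1_grid \<gamma> K1 N) y a b (real r / real N) =
      (\<Sum>i\<in>G. ((if i \<le> c then \<alpha> else \<beta>) + \<epsilon> i - (if i \<le> r then a else b))\<^sup>2)" for a b r
  proof -
    have "{i. i \<in> {1..N} \<and> real i / real N \<in> stage1_grid \<gamma> K1 N} = G"
      unfolding grid by (auto simp: G_def)
    then show ?thesis
      unfolding stump_loss_def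
      by (intro sum.cong) (auto simp: y stump_at_index[OF N] stump_floor[OF N \<tau>(1)] c_def G_def)
  qed
  \<comment> \<open>The largest grid index not exceeding \<open>c\<close>: splitting there reproduces the true stump on the grid.\<close>
  define r0 where "r0 = k * (c div k)"
  have r0: "r0 \<in> G" "r0 \<le> c"
    using k \<open>c < N\<close> by (auto simp: r0_def G_def div_greater_zero_iff intro: le_less_trans[OF times_div_less_eq_dividend])
  have r0_c: "i \<le> r0 \<longleftrightarrow> i \<le> c" if "i \<in> G" for i
  proof
    assume "i \<le> c"
    have "k dvd i" using that by (simp add: G_def)
    then obtain j where "i = k * j" by (rule dvdE)
    then have "j \<le> c div k" using \<open>i \<le> c\<close> k by (simp add: less_eq_div_iff_mult_less_eq mult.commute)
    then show "i \<le> r0" using \<open>i = k * j\<close> by (simp add: r0_def)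
  qed (use r0 in simp)
  have r0_grid: "real r0 / real N \<in> {0<..<1}" "real r0 / real N \<in> stage1_grid \<gamma> K1 N"
    using r0 grid N by (auto simp: G_def)
  have t1: "t1 \<in> stage1_grid \<gamma> K1 N"
    and le: "\<not> stump_loss N (stage1_grid \<gamma> K1 N) y \<alpha> \<beta> (real r0 / real N) < stump_loss N (stage1_grid \<gamma> K1 N) y a1 b1 t1"
    using min r0_grid unfolding stage1_minimizer_def is_arg_min_def by auto
  from t1 obtain r where r: "t1 = real r / real N" unfolding stage1_grid_def by auto
  have "(\<Sum>i\<in>G. ((if i \<le> c then \<alpha> else \<beta>) + \<epsilon> i - (if i \<le> r0 then \<alpha> else \<beta>))\<^sup>2) = (\<Sum>i\<in>G. (\<epsilon> i)\<^sup>2)"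
    by (intro sum.cong) (auto simp: r0_c)
  then show thesis
    using that[of r] t1 le r grid[of r] by (simp add: loss)
qed

lemma stage2_minimizer_index:
  assumes min: "stage2_minimizer \<gamma> \<delta> K1 K2 N y a b t1 t2" and N: "0 < N"
  defines "U \<equiv> {i\<in>{1..N}. real i / real N \<notin> stage1_grid \<gamma> K1 N}"
  defines "W \<equiv> {i\<in>U. \<bar>real i / real N - t1\<bar> \<le> K2 * real N powr (-\<gamma> + \<delta>)}"
  obtains d where "d \<in> W" "t2 = real d / real N"
    "\<And>d'. d' \<in> W \<Longrightarrow> (\<Sum>i\<in>W. (y i - (if i \<le> d then a else b))\<^sup>2) \<le> (\<Sum>i\<in>W. (y i - (if i \<le> d' then a else b))\<^sup>2)"
proof -
  have grid: "real i / real N \<in> stage2_grid \<gamma> \<delta> K1 K2 N t1 \<longleftrightarrow> i \<in> W" for i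
  proof -
    have "real i / real N = real j / real N \<longleftrightarrow> i = j" for j using N by simp
    then show ?thesis by (auto simp: stage2_grid_def W_def U_def abs_le_iff)
  qed
  have loss: "stump_loss N (stage2_grid \<gamma> \<delta> K1 K2 N t1) y a b (real r / real N) =
      (\<Sum>i\<in>W. (y i - (if i \<le> r then a else b))\<^sup>2)" for r
  proof -
    have "{i. i \<in> {1..N} \<and> real i / real N \<in> stage2_grid \<gamma> \<delta> K1 K2 N t1} = W"
      unfolding grid by (auto simp: W_def U_def)
    then show ?thesis
      unfolding stump_loss_def by (intro sum.cong) (auto simp: stump_at_index[OF N])
  qed
  have t2: "t2 \<in> stage2_grid \<gamma> \<delta> K1 K2 N t1"
    and le: "\<And>t. t \<in> stage2_grid \<gamma> \<delta> K1 K2 N t1 \<Longrightarrow>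
      stump_loss N (stage2_grid \<gamma> \<delta> K1 K2 N t1) y a b t2 \<le> stump_loss N (stage2_grid \<gamma> \<delta> K1 K2 N t1) y a b t"
    using min unfolding stage2_minimizer_def is_arg_min_def by (auto simp: not_less)
  from t2 obtain d where d: "t2 = real d / real N" unfolding stage2_grid_def by auto
  show thesis
  proof (rule that[OF _ d])
    show "d \<in> W" using t2 d grid by simp
    show "(\<Sum>i\<in>W. (y i - (if i \<le> d then a else b))\<^sup>2) \<le> (\<Sum>i\<in>W. (y i - (if i \<le> d' then a else b))\<^sup>2)" if "d' \<in> W" for d'
      using le[of "real d' / real N"] that grid by (simp add: loss d)
  qed
qed

lemma card_nongrid_ge:
  assumes "0 < N" "s + h \<le> N" "h \<le> nat \<lfloor>real N / (K1 * real N powr \<gamma>)\<rfloor>"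
  shows "h - 1 \<le> card {j\<in>{j\<in>{1..N}. real j / real N \<notin> stage1_grid \<gamma> K1 N}. s < j \<and> j \<le> s + h}"
    (is "_ \<le> card ?A")
proof -
  have "h - 1 \<le> card {i. s < i \<and> i \<le> s + h \<and> \<not> nat \<lfloor>real N / (K1 * real N powr \<gamma>)\<rfloor> dvd i}"
    using assms(3) by (rule card_nonmultiples_ge)
  also have "\<dots> \<le> card ?A"
    using assms(2) by (intro card_mono) (auto simp: stage1_grid_iff[OF assms(1)])
  finally show ?thesis .
qed

text \<open>Of \<open>B + 2\<close> consecutive indices at most one is on the coarse grid, so
  \<open>B + 1\<close> remain on either side. The left side needs all of them, for the ranks from
  \<open>- B\<close> to 0.\<close>

lemma rank_range_nongrid:
  assumes N: "0 < N" and B: "B + 2 \<le> nat \<lfloor>real N / (K1 * real N powr \<gamma>)\<rfloor>" "B + 2 \<le> c" "c + B + 2 \<le> N"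
  defines "U \<equiv> {i\<in>{1..N}. real i / real N \<notin> stage1_grid \<gamma> K1 N}"
  shows "B \<le> card {j\<in>U. c < j \<and> j \<le> c + (B + 2)}" (is "B \<le> ?above")
    and "B < card {j\<in>U. c - (B + 2) < j \<and> j \<le> c}" (is "B < ?below")
    and "{- int B..int B} \<subseteq> {1 - int (card {j\<in>U. j \<le> c})..int (card {j\<in>U. c < j})}"
proof -
  show above: "B \<le> ?above"
    using card_nongrid_ge[OF N _ B(1), of c] B(3) unfolding U_def by simp
  obtain s where s: "c = s + (B + 2)" using B(2) by (metis le_add_diff_inverse2)
  show below: "B < ?below"
    using card_nongrid_ge[OF N _ B(1), of s] B(3) unfolding U_def s by simp
  have "?above \<le> card {j\<in>U. c < j}" "?below \<le> card {j\<in>U. j \<le> c}"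
    by (auto simp: U_def intro!: card_mono)
  then show "{- int B..int B} \<subseteq> {1 - int (card {j\<in>U. j \<le> c})..int (card {j\<in>U. c < j})}"
    using above below by auto
qed

text \<open>Deterministic core for one realization of the noise. At most \<open>H\<close> coarse
  points separate the first-stage estimate from the truth, hence at most \<open>k * (H + 1)\<close>
  indices. By \<open>window\<close> the second window reaches \<open>B + 2\<close> indices beyond
  this error, so every rank up to \<open>B\<close> in modulus competes in the second stage.\<close>

lemma two_stage_walk_near_min:
  fixes \<gamma> \<delta> K1 K2 \<alpha> \<beta> \<tau> \<sigma> \<eta> \<kappa> g a1 b1 t1 t2 :: real and y \<epsilon> :: "nat \<Rightarrow> real" and N B :: nat
  assumes N: "0 < N" and \<tau>: "0 < \<tau>" "\<tau> < 1" and ne: "\<alpha> \<noteq> \<beta>" and "0 < \<sigma>"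
    and y: "\<And>i. i \<in> {1..N} \<Longrightarrow> y i = stump \<alpha> \<beta> \<tau> (real i / real N) + \<epsilon> i"
    and min1: "stage1_minimizer \<gamma> K1 N y a1 b1 t1"
    and min2: "stage2_minimizer \<gamma> \<delta> K1 K2 N y a1 b1 t1 t2"
  defines "k \<equiv> nat \<lfloor>real N / (K1 * real N powr \<gamma>)\<rfloor>" and "c \<equiv> nat \<lfloor>real N * \<tau>\<rfloor>"
  defines "G \<equiv> {i. 0 < i \<and> i < N \<and> k dvd i}"
    and "U \<equiv> {i\<in>{1..N}. real i / real N \<notin> stage1_grid \<gamma> K1 N}"
  defines "\<pi> \<equiv> inv_into U (rank_from U c)"
  assumes noise: "\<And>s t. \<bar>\<Sum>i | i \<in> G \<and> s < i \<and> i \<le> t. \<epsilon> i\<bar> \<le> \<kappa> * sqrt (card {i\<in>G. s < i \<and> i \<le> t})"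
    and "0 < \<kappa>" and \<eta>: "0 < \<eta>" "\<eta> < \<bar>\<beta> - \<alpha>\<bar> / 2"
    and g: "g \<le> real c / real k - 1" "g \<le> (real N - 1 - real c) / real k - 1"
      "12 * \<kappa>\<^sup>2 \<le> \<eta>\<^sup>2 * (g - 48 * \<kappa>\<^sup>2 / (\<beta> - \<alpha>)\<^sup>2)"
    and B: "B + 2 \<le> k" "B + 2 \<le> c" "c + B + 2 \<le> N"
    and window: "real k * (48 * \<kappa>\<^sup>2 / (\<beta> - \<alpha>)\<^sup>2 + 1) + real (B + 2) \<le> K2 * real N powr (-\<gamma> + \<delta>) * real N"
  defines "\<Lambda> \<equiv> signed_count \<gamma> K1 N (real c / real N) t2"
    and "X \<equiv> drift_walk ((\<beta> - \<alpha>) / \<sigma>) (\<lambda>m. \<epsilon> (\<pi> m) / \<sigma>)"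
  shows "\<Lambda> \<in> {1 - int (card {j\<in>U. j \<le> c})..int (card {j\<in>U. c < j})}"
    and "\<forall>i\<in>{- int B..int B}. X \<Lambda> \<le> X i + real_of_int (\<bar>\<Lambda>\<bar> + \<bar>i\<bar>) * (\<eta> / \<sigma>)"
proof -
  define H where "H = 48 * \<kappa>\<^sup>2 / (\<beta> - \<alpha>)\<^sup>2"
  have "0 \<le> H" by (simp add: H_def)
  have "0 < k" using B by simp
  \<comment> \<open>The threshold inequality forces \<open>g\<close> to be positive, and so a coarse
    grid point at or before \<open>c\<close> exists.\<close>
  have "0 < \<eta>\<^sup>2 * (g - H)"
    using g(3) zero_less_power[OF \<open>0 < \<kappa>\<close>, of 2] unfolding H_def[symmetric] by linarith
  then have "0 < g" using \<eta> \<open>0 \<le> H\<close> by (simp add: zero_less_mult_iff)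
  then have "1 \<le> real c / real k" using g(1) by simp
  then have "k \<le> c" using \<open>0 < k\<close> by (simp add: le_divide_eq)
  have "c < N" using B by simp
  have finG: "finite G" and finU: "finite U" by (auto simp: G_def U_def)
  obtain r where r: "r \<in> G" "t1 = real r / real N"
    and fit: "(\<Sum>i\<in>G. ((if i \<le> c then \<alpha> else \<beta>) + \<epsilon> i - (if i \<le> r then a1 else b1))\<^sup>2) \<le> (\<Sum>i\<in>G. (\<epsilon> i)\<^sup>2)"
    by (rule stage1_minimizer_fit[OF min1 N \<tau> y, folded k_def c_def, folded G_def, OF _ \<open>0 < k\<close> \<open>k \<le> c\<close>])
  have count: "(real t - real s) / real k - 1 \<le> card {i\<in>G. s < i \<and> i \<le> t}" if "s \<le> t" "t < N" for s t
  proof -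
    have "{i\<in>G. s < i \<and> i \<le> t} = {i. s < i \<and> i \<le> t \<and> k dvd i}" using that by (auto simp: G_def)
    then show ?thesis using card_multiples_ge[OF \<open>0 < k\<close> \<open>s \<le> t\<close>] by simp
  qed
  have g1: "g \<le> card {i\<in>G. i \<le> c}"
  proof -
    have "{i\<in>G. i \<le> c} = {i\<in>G. 0 < i \<and> i \<le> c}" by (auto simp: G_def)
    then show ?thesis using g(1) count[of 0 c] \<open>c < N\<close> by simp
  qed
  have g2: "g \<le> card {i\<in>G. c < i}"
  proof -
    have "{i\<in>G. c < i} = {i\<in>G. c < i \<and> i \<le> N - 1}" by (auto simp: G_def)
    moreover have N1: "real (N - 1) = real N - 1" "c \<le> N - 1" "N - 1 < N" using \<open>c < N\<close> by (auto simp: of_nat_diff)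
    ultimately show ?thesis using g(2) count[OF N1(2,3)] unfolding N1(1) by simp
  qed
  have pos: "0 < i" if "i \<in> G" for i using that by (simp add: G_def)
  note acc = stump_fit_accuracy[where G = G and \<epsilon> = \<epsilon> and \<kappa> = \<kappa> and c = c and r = r and a = a1 and b = b1
      and \<alpha> = \<alpha> and \<beta> = \<beta> and \<eta> = \<eta> and g = g,
      OF finG noise pos fit ne \<open>0 < \<kappa>\<close> \<eta>(1) less_imp_le[OF \<eta>(2)] g1 g2 g(3)]
  have ab: "\<bar>a1 - \<alpha>\<bar> \<le> \<eta>" "\<bar>b1 - \<beta>\<bar> \<le> \<eta>" and "card {i\<in>G. min r c < i \<and> i \<le> max r c} \<le> H"
    using acc by (simp_all add: H_def)
  moreover have "(real (max r c) - real (min r c)) / real k - 1 \<le> card {i\<in>G. min r c < i \<and> i \<le> max r c}"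
    using r \<open>c < N\<close> by (intro count) (auto simp: G_def)
  \<comment> \<open>The number of grid points between the two splits is at least their distance over
    the spacing minus 1, and at most \<open>H\<close>.\<close>
  ultimately have "(real (max r c) - real (min r c)) / real k \<le> H + 1" by linarith
  then have rc: "real (max r c) - real (min r c) \<le> real k * (H + 1)"
    using \<open>0 < k\<close> by (simp add: divide_le_eq mult.commute)
  define W where "W = {i\<in>U. \<bar>real i / real N - t1\<bar> \<le> K2 * real N powr (-\<gamma> + \<delta>)}"
  have W_near: "x \<in> W" if "x \<in> U" "c - (B + 2) < x" "x \<le> c + (B + 2)" for x
  proof -
    have "\<bar>real x - real r\<bar> \<le> K2 * real N powr (-\<gamma> + \<delta>) * real N"
      using that(2,3) rc window B unfolding H_def[symmetric] by (auto simp: max_def min_def split: if_splits)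
    then have "\<bar>real x - real r\<bar> / real N \<le> K2 * real N powr (-\<gamma> + \<delta>)"
      using N by (simp add: divide_le_eq)
    moreover have "\<bar>real x / real N - t1\<bar> = \<bar>real x - real r\<bar> / real N"
      using N by (simp add: r(2) flip: diff_divide_distrib)
    ultimately show ?thesis using that by (simp add: W_def)
  qed
  let ?r = "rank_from U c"
  let ?lo = "1 - int (card {j\<in>U. j \<le> c})" and ?hi = "int (card {j\<in>U. c < j})"
  have bij: "bij_betw ?r U {?lo..?hi}" by (rule rank_from_bij[OF finU])
  note range = rank_range_nongrid[OF N, of B K1 \<gamma> c, folded k_def U_def, OF B]
  have \<pi>: "\<pi> i \<in> U" "?r (\<pi> i) = i" if "i \<in> {- int B..int B}" for i
    using subsetD[OF range(3) that] bij_betw_imp_surj_on[OF bij] inv_into_into[of i ?r U] f_inv_into_f[of i ?r U]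
    unfolding \<pi>_def by simp_all
  have \<pi>W: "\<pi> i \<in> W" if "i \<in> {- int B..int B}" for i
  proof -
    have small: "\<bar>?r (\<pi> i)\<bar> \<le> int B" using \<pi>[OF that] that by auto
    show ?thesis
      by (intro W_near \<pi>[OF that] rank_from_small[OF finU \<pi>(1)[OF that] small range(1,2)])
  qed
  obtain d where d: "d \<in> W" "t2 = real d / real N"
    and opt: "\<And>d'. d' \<in> W \<Longrightarrow> (\<Sum>i\<in>W. (y i - (if i \<le> d then a1 else b1))\<^sup>2) \<le> (\<Sum>i\<in>W. (y i - (if i \<le> d' then a1 else b1))\<^sup>2)"
    by (rule stage2_minimizer_index[OF min2 N, folded U_def, folded W_def]) (blast intro: that)
  have \<Lambda>: "\<Lambda> = ?r d"
    unfolding \<Lambda>_def d(2) signed_count_eq_rank[OF N] U_def ..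
  have "d \<in> U" using d by (simp add: W_def)
  then show "\<Lambda> \<in> {?lo..?hi}" using bij unfolding \<Lambda> by (auto simp: bij_betw_def)
  let ?L = "\<lambda>d. \<Sum>i\<in>W. (y i - (if i \<le> d then a1 else b1))\<^sup>2"
  define C where "C = 2 * \<sigma> * \<bar>b1 - a1\<bar>"
  have "b1 \<noteq> a1" using ab \<eta>(2) by auto
  then have "0 < C" using \<open>0 < \<sigma>\<close> by (simp add: C_def)
  \<comment> \<open>The index of rank zero serves as reference split: no index of \<open>U\<close>
    lies strictly between it and the true change point, and the walk is 0 there.\<close>
  define z where "z = \<pi> 0"
  have yU: "y i = (if i \<le> c then \<alpha> else \<beta>) + \<epsilon> i" if "i \<in> U" for i
    using that y[of i] by (simp add: U_def stump_floor[OF N \<tau>(1)] c_def)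
  have W_convex: "j \<in> W" if "j \<in> U" "u \<in> W" "v \<in> W" "min u v \<le> j" "j \<le> max u v" for j u v
  proof -
    have "real (min u v) / real N \<le> real j / real N" "real j / real N \<le> real (max u v) / real N"
      using that N by (simp_all add: divide_right_mono)
    then show ?thesis
      using that unfolding W_def by (auto simp: max_def min_def abs_le_iff split: if_splits)
  qed
  have close: "\<bar>(?L x - ?L z) / C - X (?r x)\<bar> \<le> \<bar>?r x\<bar> * (\<eta> / \<sigma>)" if "x \<in> W" for x
    unfolding C_def X_def
  proof (rule loss_difference_close[OF finU])
    show "z \<in> W" "?r z = 0" using \<pi>W[of 0] \<pi>[of 0] by (auto simp: z_def)
    then show "j \<in> W" if "j \<in> U" "min z x \<le> j" "j \<le> max z x" for j
      using W_convex that \<open>x \<in> W\<close> by blast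
  qed (use that ab \<eta> \<open>0 < \<sigma>\<close> yU in \<open>auto simp: \<pi>_def W_def\<close>)
  show "\<forall>i\<in>{- int B..int B}. X \<Lambda> \<le> X i + real_of_int (\<bar>\<Lambda>\<bar> + \<bar>i\<bar>) * (\<eta> / \<sigma>)"
  proof
    fix i assume i: "i \<in> {- int B..int B}"
    \<comment> \<open>Optimality compares the losses at \<open>d\<close> and \<open>\<pi> i\<close>;
      replacing each by the walk costs an error proportional to its own rank, hence the sum of the
      two moduli.\<close>
    have "(?L d - ?L z) / C \<le> (?L (\<pi> i) - ?L z) / C"
      using opt[OF \<pi>W[OF i]] \<open>0 < C\<close> by (intro divide_right_mono) auto
    then show "X \<Lambda> \<le> X i + real_of_int (\<bar>\<Lambda>\<bar> + \<bar>i\<bar>) * (\<eta> / \<sigma>)"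
      using close[OF d(1)] close[OF \<pi>W[OF i]]
      unfolding \<pi>(2)[OF i] \<Lambda> of_int_add distrib_right abs_le_iff by linarith
  qed
qed

section \<open>Asymptotics\<close>

text \<open>Measurability is shown for the real-valued count, built from finitely many indicators;
  taking the floor then returns to the integers with the discrete sigma-algebra.\<close>

lemma signed_count_measurable [measurable]:
  "signed_count \<gamma> K1 N a \<in> borel \<rightarrow>\<^sub>M count_space UNIV"
proof -
  have "real_of_int (signed_count \<gamma> K1 N a b) =
      (if a \<le> b
       then (\<Sum>i=1..N. if a < real i / real N \<and> real i / real N \<le> b \<and> real i / real N \<notin> stage1_grid \<gamma> K1 N then 1 else 0)
       else - (\<Sum>i=1..N. if b < real i / real N \<and> real i / real N \<le> a \<and> real i / real N \<notin> stage1_grid \<gamma> K1 N then 1 else 0))" for b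
    by (simp add: signed_count_def of_bool_def if_distrib[of real_of_int] cong: if_cong)
  then have "(\<lambda>b. real_of_int (signed_count \<gamma> K1 N a b)) \<in> borel_measurable borel"
    by simp
  then have "(\<lambda>b. \<lfloor>real_of_int (signed_count \<gamma> K1 N a b)\<rfloor>) \<in> borel \<rightarrow>\<^sub>M count_space UNIV"
    by measurable
  then show ?thesis by simp
qed

lemma (in prob_space) interval_sums_bounded:
  assumes iid: "iid_centered_normal M \<sigma> \<epsilon> {1..N}" and "0 < \<sigma>" "0 \<le> \<kappa>" and G: "G \<subseteq> {1..N}"
  obtains A where "A \<in> events" "prob A \<le> real ((N + 1)\<^sup>2) * (2 * exp (- (\<kappa>\<^sup>2 / (2 * \<sigma>\<^sup>2))))"
    "\<And>\<omega> s t. \<omega> \<in> space M - A \<Longrightarrow>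
      \<bar>\<Sum>i | i \<in> G \<and> s < i \<and> i \<le> t. \<epsilon> i \<omega>\<bar> \<le> \<kappa> * sqrt (card {i\<in>G. s < i \<and> i \<le> t})"
proof -
  let ?I = "\<lambda>s t. {i\<in>G. s < i \<and> i \<le> t}"
  \<comment> \<open>For an empty interval the non-strict inequality reads 0 <= 0, which would make
    the bad event the whole space; hence the separate case.\<close>
  define E where "E = (\<lambda>(s, t). if ?I s t = {} then {}
    else {\<omega> \<in> space M. \<kappa> * sqrt (card (?I s t)) \<le> \<bar>\<Sum>i\<in>?I s t. \<epsilon> i \<omega>\<bar>})"
  have fin: "finite (?I s t)" for s t using G finite_subset by auto
  have meas: "\<epsilon> i \<in> borel_measurable M" if "i \<in> G" for i
    using iid_centered_normal_measurable[OF iid] that G by auto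
  have E: "E p \<in> events" "prob (E p) \<le> 2 * exp (- (\<kappa>\<^sup>2 / (2 * \<sigma>\<^sup>2)))" for p
  proof -
    obtain s t where p: "p = (s, t)" by (cases p)
    have "(\<lambda>\<omega>. \<Sum>i\<in>?I s t. \<epsilon> i \<omega>) \<in> borel_measurable M"
      using meas by (intro borel_measurable_sum) auto
    then show "E p \<in> events" unfolding E_def p by (auto intro!: borel_measurable_le)
    show "prob (E p) \<le> 2 * exp (- (\<kappa>\<^sup>2 / (2 * \<sigma>\<^sup>2)))"
    proof (cases "?I s t = {}")
      case False
      have "prob {\<omega> \<in> space M. \<kappa> * sqrt (card (?I s t)) \<le> \<bar>\<Sum>i\<in>?I s t. \<epsilon> i \<omega>\<bar>} \<le> 2 * exp (- (\<kappa>\<^sup>2 / (2 * \<sigma>\<^sup>2)))"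
        using G \<open>0 < \<sigma>\<close> \<open>0 \<le> \<kappa>\<close> False by (intro iid_centered_normal_sum_tail[OF iid] fin) auto
      then show ?thesis unfolding E_def p using False by (simp only: split if_False)
    qed (auto simp: E_def p)
  qed
  show thesis
  proof
    show "(\<Union>p\<in>{..N}\<times>{..N}. E p) \<in> events" using E(1) by auto
    have "prob (\<Union>p\<in>{..N}\<times>{..N}. E p) \<le> (\<Sum>p\<in>{..N}\<times>{..N}. prob (E p))"
      using E(1) by (intro measure_UNION_le) auto
    also have "\<dots> \<le> real (card ({..N}\<times>{..N})) * (2 * exp (- (\<kappa>\<^sup>2 / (2 * \<sigma>\<^sup>2))))"
      using E(2) by (intro sum_bounded_above) auto
    also have "card ({..N}\<times>{..N}) = (N + 1)\<^sup>2"
      by (simp add: card_cartesian_product power2_eq_square)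
    finally show "prob (\<Union>p\<in>{..N}\<times>{..N}. E p) \<le> real ((N + 1)\<^sup>2) * (2 * exp (- (\<kappa>\<^sup>2 / (2 * \<sigma>\<^sup>2))))" .
  next
    fix \<omega> s t assume \<omega>: "\<omega> \<in> space M - (\<Union>p\<in>{..N}\<times>{..N}. E p)"
    show "\<bar>\<Sum>i\<in>?I s t. \<epsilon> i \<omega>\<bar> \<le> \<kappa> * sqrt (card (?I s t))"
    proof (cases "?I s t = {}")
      case False
      \<comment> \<open>Clipping the right end at \<open>N\<close> leaves the interval unchanged, so
        the finite family of events covers all \<open>s\<close> and \<open>t\<close>.\<close>
      have I: "?I s (min t N) = ?I s t" "s \<le> N" using G False by auto
      have "\<omega> \<notin> E (s, min t N)" using \<omega> I(2) by auto
      then have "\<not> \<kappa> * sqrt (card (?I s t)) \<le> \<bar>\<Sum>i\<in>?I s t. \<epsilon> i \<omega>\<bar>"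
      proof -
        have "E (s, min t N) = {\<omega> \<in> space M. \<kappa> * sqrt (card (?I s t)) \<le> \<bar>\<Sum>i\<in>?I s t. \<epsilon> i \<omega>\<bar>}"
          by (simp only: E_def split I(1) if_False False)
        then show ?thesis using \<open>\<omega> \<notin> E (s, min t N)\<close> \<omega> by blast
      qed
      then show ?thesis by simp
    next
      case True
      show ?thesis unfolding True by simp
    qed
  qed
qed

text \<open>The exponent grows like N^(\<delta>/2) and outweighs the quadratic number of intervals
  however small \<open>\<delta>\<close> is.\<close>

lemma interval_sum_failure_tendsto_0:
  fixes \<sigma> \<delta> :: real
  assumes "0 < \<sigma>" "0 < \<delta>"
  shows "(\<lambda>N. real ((N + 1)\<^sup>2) * (2 * exp (- ((real N powr (\<delta> / 4))\<^sup>2 / (2 * \<sigma>\<^sup>2))))) \<longlonglongrightarrow> 0"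
proof -
  have "(\<lambda>N. real ((N + 1)\<^sup>2) * (2 * exp (- ((real N powr (\<delta> / 4))\<^sup>2 / C)))) \<longlonglongrightarrow> 0" if "0 < C" for C :: real
    using assms that by real_asymp
  then show ?thesis using assms by simp
qed

text \<open>The grid count is of order N^\<gamma>, while both noise terms are of order
  N^(\<delta>/2), which is smaller because \<open>\<delta> < \<gamma>\<close>.\<close>

lemma eventually_threshold_le:
  fixes \<gamma> \<delta> :: real
  assumes "0 < \<gamma>" "0 < \<delta>" "\<delta> < \<gamma>" "0 < K" "0 < \<theta>" "0 < C" "0 < E"
  shows "\<forall>\<^sub>F N in sequentially. 12 * (real N powr (\<delta> / 4))\<^sup>2
    \<le> C * ((real N * \<theta> - 1) * (K * real N powr \<gamma> / real N) - 1 - 48 * (real N powr (\<delta> / 4))\<^sup>2 / E)"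
proof -
  have "filterlim (\<lambda>N. C * ((real N * \<theta> - 1) * (K * real N powr \<gamma> / real N) - 1 - 48 * (real N powr (\<delta> / 4))\<^sup>2 / E)
      - 12 * (real N powr (\<delta> / 4))\<^sup>2) at_top sequentially"
    using assms by real_asymp
  then show ?thesis
    by (auto simp: filterlim_at_top_ge[of _ _ 0] elim: eventually_mono)
qed

text \<open>The localization error is of order N^(1-\<gamma>+\<delta>/2) indices against a window of
  order N^(1-\<gamma>+\<delta>); the constant \<open>b\<close> is negligible because
  \<open>\<gamma> < 1\<close>.\<close>

lemma eventually_window_le:
  fixes \<gamma> \<delta> :: real
  assumes "0 < \<delta>" "\<gamma> < 1" "0 < K1" "0 < K2" "0 < E"
  shows "\<forall>\<^sub>F N in sequentially. real N / (K1 * real N powr \<gamma>) * (48 * (real N powr (\<delta> / 4))\<^sup>2 / E + 1) + b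
    \<le> K2 * real N powr (-\<gamma> + \<delta>) * real N"
proof -
  have "filterlim (\<lambda>N. K2 * real N powr (-\<gamma> + \<delta>) * real N
     - (real N / (K1 * real N powr \<gamma>) * (48 * (real N powr (\<delta> / 4))\<^sup>2 / E + 1) + b)) at_top sequentially"
    using assms by real_asymp
  then show ?thesis
    by (auto simp: filterlim_at_top_ge[of _ _ 0] elim: eventually_mono)
qed

lemma eventually_spacing_ge:
  fixes \<gamma> :: real
  assumes "\<gamma> < 1" "0 < K1"
  shows "\<forall>\<^sub>F N in sequentially. b \<le> nat \<lfloor>real N / (K1 * real N powr \<gamma>)\<rfloor>"
proof -
  have "filterlim (\<lambda>N. real N / (K1 * real N powr \<gamma>)) at_top sequentially"
    using assms by real_asymp
  then have "\<forall>\<^sub>F N in sequentially. real b \<le> real N / (K1 * real N powr \<gamma>)"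
    by (simp add: filterlim_at_top)
  then show ?thesis
    by eventually_elim (simp add: le_nat_iff le_floor_iff)
qed

theorem theorem2:
  fixes \<gamma> \<delta> K1 K2 \<alpha> \<beta> \<tau> \<sigma> :: real
    and M :: "nat \<Rightarrow> 'a measure"
    and \<epsilon> Y :: "nat \<Rightarrow> nat \<Rightarrow> 'a \<Rightarrow> real"
    and \<alpha>1 \<beta>1 \<tau>1 \<tau>2 :: "nat \<Rightarrow> 'a \<Rightarrow> real"
    and P :: "'b measure"
    and e :: "int \<Rightarrow> 'b \<Rightarrow> real"
    and L :: "'b \<Rightarrow> int"
    and l :: int
  assumes "0 < \<gamma>" "\<gamma> < 1" "0 < K1" "0 < K2" "0 < \<delta>" "\<delta> < \<gamma>"
    and "0 < \<sigma>" "\<alpha> \<noteq> \<beta>" "0 < \<tau>" "\<tau> < 1"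
    and "\<And>N. prob_space (M N)"
    and "\<And>N. iid_centered_normal (M N) \<sigma> (\<epsilon> N) {1..N}"
    and "\<And>N i \<omega>. i \<in> {1..N} \<Longrightarrow> \<omega> \<in> space (M N) \<Longrightarrow>
           Y N i \<omega> = stump \<alpha> \<beta> \<tau> (real i / real N) + \<epsilon> N i \<omega>"
    and "\<And>N. \<alpha>1 N \<in> borel_measurable (M N)" "\<And>N. \<beta>1 N \<in> borel_measurable (M N)"
        "\<And>N. \<tau>1 N \<in> borel_measurable (M N)" "\<And>N. \<tau>2 N \<in> borel_measurable (M N)"
    and "\<forall>\<^sub>F N in sequentially. AE \<omega> in M N.
           stage1_minimizer \<gamma> K1 N (\<lambda>i. Y N i \<omega>) (\<alpha>1 N \<omega>) (\<beta>1 N \<omega>) (\<tau>1 N \<omega>)"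
    and "\<forall>\<^sub>F N in sequentially. AE \<omega> in M N.
           stage2_minimizer \<gamma> \<delta> K1 K2 N (\<lambda>i. Y N i \<omega>)
             (\<alpha>1 N \<omega>) (\<beta>1 N \<omega>) (\<tau>1 N \<omega>) (\<tau>2 N \<omega>)"
    and "prob_space P"
    and "iid_centered_normal P 1 e UNIV"
    and "argmin_drift_walk P ((\<beta> - \<alpha>) / \<sigma>) e L"
  shows "(\<lambda>N. measure (M N) {\<omega> \<in> space (M N).
             signed_count \<gamma> K1 N (real_of_int \<lfloor>real N * \<tau>\<rfloor> / real N) (\<tau>2 N \<omega>) = l})
         \<longlonglongrightarrow> measure P {\<omega> \<in> space P. L \<omega> = l}"
proof -
  define k where "k N = nat \<lfloor>real N / (K1 * real N powr \<gamma>)\<rfloor>" for N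
  define c where "c N = nat \<lfloor>real N * \<tau>\<rfloor>" for N
  define U where "U N = {i\<in>{1..N}. real i / real N \<notin> stage1_grid \<gamma> K1 N}" for N
  define G where "G N = {i. 0 < i \<and> i < N \<and> k N dvd i}" for N
  define \<pi> where "\<pi> N = inv_into (U N) (rank_from (U N) (c N))" for N
  define \<xi> where "\<xi> N m \<omega> = \<epsilon> N (\<pi> N m) \<omega> / \<sigma>" for N m \<omega>
  define lo where "lo N = 1 - int (card {j\<in>U N. j \<le> c N})" for N
  define hi where "hi N = int (card {j\<in>U N. c N < j})" for N
  define \<Lambda> where "\<Lambda> N \<omega> = signed_count \<gamma> K1 N (real (c N) / real N) (\<tau>2 N \<omega>)" for N \<omega>
  define D where "D = (\<beta> - \<alpha>) / \<sigma>"
  define \<kappa> where "\<kappa> N = real N powr (\<delta> / 4)" for N :: nat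
  \<comment> \<open>The shorter of the two segments, so that one bound \<open>g\<close> serves the
    grid points on both sides of the change.\<close>
  define \<theta> where "\<theta> = min \<tau> (1 - \<tau>)"
  define g where "g N = (real N * \<theta> - 1) * (K1 * real N powr \<gamma> / real N) - 1" for N :: nat
  note pos = \<open>0 < \<gamma>\<close> \<open>\<gamma> < 1\<close> \<open>0 < K1\<close> \<open>0 < K2\<close> \<open>0 < \<delta>\<close> \<open>\<delta> < \<gamma>\<close> \<open>0 < \<sigma>\<close> \<open>0 < \<tau>\<close> \<open>\<tau> < 1\<close>
  note prob = \<open>\<And>N. prob_space (M N)\<close> and iid = \<open>\<And>N. iid_centered_normal (M N) \<sigma> (\<epsilon> N) {1..N}\<close>
  note obs = \<open>\<And>N i \<omega>. i \<in> {1..N} \<Longrightarrow> \<omega> \<in> space (M N) \<Longrightarrow>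
           Y N i \<omega> = stump \<alpha> \<beta> \<tau> (real i / real N) + \<epsilon> N i \<omega>\<close>
  note [measurable] = \<open>\<And>N. \<tau>2 N \<in> borel_measurable (M N)\<close>
  have "\<theta> > 0" using pos by (simp add: \<theta>_def)
  have c: "real (c N) \<le> real N * \<tau>" "real N * \<tau> - 1 \<le> real (c N)" for N
    using pos by (simp_all add: c_def)
  have finU: "finite (U N)" for N by (simp add: U_def)
  have bij: "bij_betw (rank_from (U N) (c N)) (U N) {lo N..hi N}" for N
    unfolding lo_def hi_def by (rule rank_from_bij[OF finU])
  have bij\<pi>: "bij_betw (\<pi> N) {lo N..hi N} (U N)" for N
    unfolding \<pi>_def by (rule bij_betw_inv_into[OF bij])
  have large: "\<forall>\<^sub>F N in sequentially. b \<le> real N * x" if "0 < x" for b x :: real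
  proof -
    have "filterlim (\<lambda>N. real N * x) at_top sequentially" using that by real_asymp
    then show ?thesis by (simp add: filterlim_at_top)
  qed
  have "0 < 1 - \<tau>" using pos by simp
  \<comment> \<open>\<open>B + 3\<close> on the left, against \<open>B + 2\<close> on the right,
    compensates for the rounding down in \<open>c N\<close>.\<close>
  have range_conditions: "\<forall>\<^sub>F N in sequentially. 0 < N \<and> B + 2 \<le> k N \<and> B + 2 \<le> c N \<and> c N + B + 2 \<le> N" for B
    using eventually_gt_at_top[of 0] eventually_spacing_ge[OF \<open>\<gamma> < 1\<close> \<open>0 < K1\<close>, of "B + 2"]
      large[OF \<open>0 < \<tau>\<close>, of "real (B + 3)"] large[OF \<open>0 < 1 - \<tau>\<close>, of "real (B + 2)"]
  proof eventually_elim
    case (elim N)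
    have "real (B + 2) \<le> real (c N)" "real (c N + B + 2) \<le> real N"
      using elim(3,4) c[of N] pos by (simp_all add: algebra_simps)
    then show ?case using elim(1,2) unfolding k_def of_nat_le_iff by simp
  qed
  have "(\<lambda>N. measure (M N) {\<omega> \<in> space (M N). \<Lambda> N \<omega> = l}) \<longlonglongrightarrow> measure P {\<omega> \<in> space P. L \<omega> = l}"
  proof (rule argmin_walk_limit[OF prob \<open>prob_space P\<close>, where D = D and \<xi> = \<xi> and lo = lo and hi = hi])
    show "D \<noteq> 0" using \<open>\<alpha> \<noteq> \<beta>\<close> pos by (simp add: D_def)
    show "iid_centered_normal P 1 e UNIV" by fact
    show "argmin_drift_walk P D e L" unfolding D_def by fact
    show "\<Lambda> N \<in> M N \<rightarrow>\<^sub>M count_space UNIV" for N unfolding \<Lambda>_def by measurable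
    show "\<forall>\<^sub>F N in sequentially. iid_centered_normal (M N) 1 (\<xi> N) {lo N..hi N}"
    proof (rule always_eventually, rule allI)
      fix N
      interpret prob_space "M N" by (rule prob)
      show "iid_centered_normal (M N) 1 (\<xi> N) {lo N..hi N}"
        unfolding \<xi>_def using bij\<pi>[of N] pos
        by (intro iid_centered_normal_reindex[OF iid]) (auto simp: bij_betw_def U_def)
    qed
    show "\<forall>\<^sub>F N in sequentially. {- int B..int B} \<subseteq> {lo N..hi N}" for B
      using range_conditions[of B]
    proof eventually_elim
      case (elim N)
      then show ?case
        unfolding lo_def hi_def U_def k_def by (intro rank_range_nongrid(3)) auto
    qed
    fix B and \<eta> :: real assume "0 < \<eta>"
    \<comment> \<open>The first entry turns the error per rank, \<open>\<eta>' / \<sigma>\<close>,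
      into at most \<open>\<eta>\<close>; the second stays strictly below half the jump, so that the
      fitted levels keep their order.\<close>
    define \<eta>' where "\<eta>' = min (\<eta> * \<sigma>) (\<bar>\<beta> - \<alpha>\<bar> / 4)"
    have \<eta>': "0 < \<eta>'" "\<eta>' < \<bar>\<beta> - \<alpha>\<bar> / 2" "\<eta>' / \<sigma> \<le> \<eta>"
    proof -
      have "\<eta>' \<le> \<bar>\<beta> - \<alpha>\<bar> / 4" unfolding \<eta>'_def by (rule min.cobounded2)
      also have "\<bar>\<beta> - \<alpha>\<bar> / 4 < \<bar>\<beta> - \<alpha>\<bar> / 2" using \<open>\<alpha> \<noteq> \<beta>\<close> by (simp add: field_simps)
      finally show "\<eta>' < \<bar>\<beta> - \<alpha>\<bar> / 2" .
    qed (use \<open>0 < \<eta>\<close> \<open>\<alpha> \<noteq> \<beta>\<close> pos in \<open>auto simp: \<eta>'_def divide_le_eq\<close>)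
    have E: "0 < (\<beta> - \<alpha>)\<^sup>2" using \<open>\<alpha> \<noteq> \<beta>\<close> by simp
    have "\<forall>\<^sub>F N in sequentially. real ((N + 1)\<^sup>2) * (2 * exp (- ((\<kappa> N)\<^sup>2 / (2 * \<sigma>\<^sup>2)))) < \<eta>"
      unfolding \<kappa>_def using order_tendstoD(2)[OF interval_sum_failure_tendsto_0[OF \<open>0 < \<sigma>\<close> \<open>0 < \<delta>\<close>] \<open>0 < \<eta>\<close>] .
    moreover have "\<forall>\<^sub>F N in sequentially. 12 * (\<kappa> N)\<^sup>2 \<le> \<eta>'\<^sup>2 * (g N - 48 * (\<kappa> N)\<^sup>2 / (\<beta> - \<alpha>)\<^sup>2)"
      unfolding \<kappa>_def g_def using pos \<open>0 < \<theta>\<close> \<eta>'(1) E by (intro eventually_threshold_le) auto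
    moreover have "\<forall>\<^sub>F N in sequentially. real N / (K1 * real N powr \<gamma>) * (48 * (\<kappa> N)\<^sup>2 / (\<beta> - \<alpha>)\<^sup>2 + 1) + real (B + 2)
        \<le> K2 * real N powr (-\<gamma> + \<delta>) * real N"
      unfolding \<kappa>_def using pos E by (intro eventually_window_le) auto
    moreover have "\<forall>\<^sub>F N in sequentially. 1 \<le> real N * \<theta>"
      by (rule large[OF \<open>0 < \<theta>\<close>])
    ultimately show "\<forall>\<^sub>F N in sequentially. \<exists>A\<in>sets (M N). measure (M N) A \<le> \<eta> \<and>
      (AE \<omega> in M N. \<omega> \<notin> A \<longrightarrow> \<Lambda> N \<omega> \<in> {lo N..hi N} \<and>
        (\<forall>i\<in>{- int B..int B}. drift_walk D (\<lambda>j. \<xi> N j \<omega>) (\<Lambda> N \<omega>)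
          \<le> drift_walk D (\<lambda>j. \<xi> N j \<omega>) i + real_of_int (\<bar>\<Lambda> N \<omega>\<bar> + \<bar>i\<bar>) * \<eta>))"
      using range_conditions[of B]
        \<open>\<forall>\<^sub>F N in sequentially. AE \<omega> in M N.
           stage1_minimizer \<gamma> K1 N (\<lambda>i. Y N i \<omega>) (\<alpha>1 N \<omega>) (\<beta>1 N \<omega>) (\<tau>1 N \<omega>)\<close>
        \<open>\<forall>\<^sub>F N in sequentially. AE \<omega> in M N.
           stage2_minimizer \<gamma> \<delta> K1 K2 N (\<lambda>i. Y N i \<omega>)
             (\<alpha>1 N \<omega>) (\<beta>1 N \<omega>) (\<tau>1 N \<omega>) (\<tau>2 N \<omega>)\<close>
    proof eventually_elim
      case (elim N)
      interpret prob_space "M N" by (rule prob)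
      have N: "0 < N" and range: "B + 2 \<le> k N" "B + 2 \<le> c N" "c N + B + 2 \<le> N" using elim(5) by auto
      have "0 < k N" using range by simp
      have k: "real (k N) \<le> real N / (K1 * real N powr \<gamma>)"
        using pos by (simp add: k_def)
      have "K1 * real N powr \<gamma> / real N \<le> 1 / real (k N)"
        using k \<open>0 < k N\<close> N pos by (simp add: field_simps)
      \<comment> \<open>Replacing the nominal inverse spacing by the larger \<open>1 / k N\<close>
        is monotone only for a nonnegative factor, which is why
        \<open>1 \<le> real N * \<theta>\<close> was collected above.\<close>
      then have g_le: "g N \<le> x / real (k N) - 1" if "real N * \<theta> - 1 \<le> x" for x
        using mult_mono[OF that, of "K1 * real N powr \<gamma> / real N" "1 / real (k N)"] elim(4) pos that
        by (simp add: g_def)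
      have g: "g N \<le> real (c N) / real (k N) - 1" "g N \<le> (real N - 1 - real (c N)) / real (k N) - 1"
      proof -
        have "real N * \<theta> \<le> real N * \<tau>" "real N * \<theta> \<le> real N * (1 - \<tau>)"
          by (intro mult_left_mono; simp add: \<theta>_def)+
        then show "g N \<le> real (c N) / real (k N) - 1" "g N \<le> (real N - 1 - real (c N)) / real (k N) - 1"
          using c[of N] by (intro g_le; simp add: algebra_simps)+
      qed
      have window: "real (k N) * (48 * (\<kappa> N)\<^sup>2 / (\<beta> - \<alpha>)\<^sup>2 + 1) + real (B + 2) \<le> K2 * real N powr (-\<gamma> + \<delta>) * real N"
        using mult_right_mono[OF k, of "48 * (\<kappa> N)\<^sup>2 / (\<beta> - \<alpha>)\<^sup>2 + 1"] elim(3) by simp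
      have "0 < \<kappa> N" using N by (simp add: \<kappa>_def)
      have "G N \<subseteq> {1..N}" by (auto simp: G_def)
      from interval_sums_bounded[OF iid \<open>0 < \<sigma>\<close> less_imp_le[OF \<open>0 < \<kappa> N\<close>] this]
      obtain A where A: "A \<in> events" "prob A \<le> real ((N + 1)\<^sup>2) * (2 * exp (- ((\<kappa> N)\<^sup>2 / (2 * \<sigma>\<^sup>2))))"
        and noise: "\<And>\<omega> s t. \<omega> \<in> space (M N) - A \<Longrightarrow>
          \<bar>\<Sum>i | i \<in> G N \<and> s < i \<and> i \<le> t. \<epsilon> N i \<omega>\<bar> \<le> \<kappa> N * sqrt (card {i\<in>G N. s < i \<and> i \<le> t})"
        by blast
      have "AE \<omega> in M N. \<omega> \<notin> A \<longrightarrow> \<Lambda> N \<omega> \<in> {lo N..hi N} \<and>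
        (\<forall>i\<in>{- int B..int B}. drift_walk D (\<lambda>j. \<xi> N j \<omega>) (\<Lambda> N \<omega>)
          \<le> drift_walk D (\<lambda>j. \<xi> N j \<omega>) i + real_of_int (\<bar>\<Lambda> N \<omega>\<bar> + \<bar>i\<bar>) * \<eta>)"
        using elim(6,7) AE_space
      proof (eventually_elim, intro impI)
        fix \<omega>
        assume min: "stage1_minimizer \<gamma> K1 N (\<lambda>i. Y N i \<omega>) (\<alpha>1 N \<omega>) (\<beta>1 N \<omega>) (\<tau>1 N \<omega>)"
            "stage2_minimizer \<gamma> \<delta> K1 K2 N (\<lambda>i. Y N i \<omega>) (\<alpha>1 N \<omega>) (\<beta>1 N \<omega>) (\<tau>1 N \<omega>) (\<tau>2 N \<omega>)"
          and \<omega>: "\<omega> \<in> space (M N)" "\<omega> \<notin> A"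
        have noise_\<omega>: "\<bar>\<Sum>i | i \<in> G N \<and> s < i \<and> i \<le> t. \<epsilon> N i \<omega>\<bar> \<le> \<kappa> N * sqrt (card {i\<in>G N. s < i \<and> i \<le> t})" for s t
          using noise \<omega> by blast
        note near = two_stage_walk_near_min[OF N \<open>0 < \<tau>\<close> \<open>\<tau> < 1\<close> \<open>\<alpha> \<noteq> \<beta>\<close> \<open>0 < \<sigma>\<close> obs[OF _ \<omega>(1)] min,
            folded k_def c_def U_def, folded G_def, OF _ noise_\<omega> \<open>0 < \<kappa> N\<close> \<eta>'(1,2) g elim(2) range window,
            folded \<pi>_def D_def \<Lambda>_def lo_def hi_def]
        have near_min: "\<Lambda> N \<omega> \<in> {lo N..hi N}"
          "\<forall>i\<in>{- int B..int B}. drift_walk D (\<lambda>j. \<xi> N j \<omega>) (\<Lambda> N \<omega>)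
            \<le> drift_walk D (\<lambda>j. \<xi> N j \<omega>) i + real_of_int (\<bar>\<Lambda> N \<omega>\<bar> + \<bar>i\<bar>) * (\<eta>' / \<sigma>)"
          unfolding \<xi>_def by (rule near, assumption)+
        have "drift_walk D (\<lambda>j. \<xi> N j \<omega>) (\<Lambda> N \<omega>)
          \<le> drift_walk D (\<lambda>j. \<xi> N j \<omega>) i + real_of_int (\<bar>\<Lambda> N \<omega>\<bar> + \<bar>i\<bar>) * \<eta>"
          if "i \<in> {- int B..int B}" for i
        proof -
          have "real_of_int (\<bar>\<Lambda> N \<omega>\<bar> + \<bar>i\<bar>) * (\<eta>' / \<sigma>) \<le> real_of_int (\<bar>\<Lambda> N \<omega>\<bar> + \<bar>i\<bar>) * \<eta>"
            using \<eta>'(3) by (intro mult_left_mono) auto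
          with bspec[OF near_min(2) that] show ?thesis by linarith
        qed
        with near_min(1) show "\<Lambda> N \<omega> \<in> {lo N..hi N} \<and>
          (\<forall>i\<in>{- int B..int B}. drift_walk D (\<lambda>j. \<xi> N j \<omega>) (\<Lambda> N \<omega>)
            \<le> drift_walk D (\<lambda>j. \<xi> N j \<omega>) i + real_of_int (\<bar>\<Lambda> N \<omega>\<bar> + \<bar>i\<bar>) * \<eta>)"
          by blast
      qed
      then show ?case using A elim(1) by (intro bexI[of _ A] conjI) auto
    qed
  qed
  moreover have "real_of_int \<lfloor>real N * \<tau>\<rfloor> = real (c N)" for N
    using pos by (simp add: c_def)
  ultimately show ?thesis unfolding \<Lambda>_def by simp
qed

end
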